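(* Let $\mathcal F$ be a family of automata networks. (1) If $\mathcal F$ is universal then, for any polynomial map $\rho$, there is a polynomial distortion $\delta$ such that every $\rho$-succinct orbit graph can be embedded into (the orbit graph of) some $F\in\mathcal F$ with distortion $\delta$. In particular $\mathcal F$ contains networks with super-polynomial periods and transients, and with a super-polynomial number of disjoint periodic orbits of period at most polynomial. (2) If $\mathcal F$ is strongly universal then it embeds the orbit graph of any bounded-degree automata network with linear distortion (i.e. for every finite $Q$ and $\Delta\ge1$ there is a linear $\delta$ such that the orbit graph of every member of $\mathcal B_{Q,\Delta}$ embeds into some member of $\mathcal F$ with distortion $\delta$). In particular $\mathcal F$ contains networks with exponential periods and transients, and with an exponential number of disjoint periodic orbits of period at most linear.
   Context: An automata network is $F:Q^V\to Q^V$ with $Q,V$ finite. Its orbit graph $G_F$ is the directed graph on $Q^V$ with an edge $x\to F(x)$ for each $x$; $G_F^t$ denotes $G_{F^t}$. Periods and transients are those of orbits $(F^t(x))_t$ (least $\tau,p\ge1$ with $F^{\tau+p}(x)=F^\tau(x)$). For $\rho:\mathbb N\to\mathbb N$, the orbit graph of $F$ with $n$ nodes is $\rho$-succinct if $F$ has a circuit encoding of size at most $\rho(n)$. For $\delta:\mathbb N\to\mathbb N$, the orbit graph of $H$ with $m$ nodes embeds $G_F$ ($F$ with $n$ nodes) with distortion $\delta$ if $m\le\delta(n)$ and there is $T\le\delta(n)$ such that $G_F$ is (isomorphic to) a subgraph of $G_{H^T}$. Representations and simulation. A communication graph of $F$ is a directed graph on $V$ such that $F(x)_v$ depends only on in-neighbours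 of $v$. For each finite alphabet fix an injective $m_Q:Q\to\{0,1\}^{k_Q}$ extended cellwise; a circuit encoding of $F:Q^n\to Q^n$ is a Boolean circuit $C$ with $m_Q\circ F=C\circ m_Q$. Families are taken with a standard representation: a language with a logarithmic-space algorithm producing a circuit encoding of a member from each word, all members represented. A block embedding of $Q_F^{V_F}$ into $Q_G^{V_G}$ is a partition $(D_i)_{i\in V_F}$ of $V_G$ with patterns $p_{i,q}\in Q_G^{D_i}$ injective in $q$, giving $\phi(x)|_{D_i}=p_{i,x_i}$; $G$ simulates $F$ via $\phi$ with time constant $T$ if $\phi\circ F=G^T\circ\phi$. A family $(\mathcal F,\mathcal F^* )$ simulates $(\mathcal H,\mathcal H^* )$ in time $T$ and space $S$ if a logarithmic-space Turing machine maps each word representing $H:Q_H^n\to Q_H^n$ to a word representing $F\in\mathcal F$ on $S(n)$ nodes, the number $T(n)$ and a block embedding via which $F$ simulates $H$ with time constant $T(n)$. $\mathcal U_{Q,P}$ ($P$ polynomial) is the family of all $F:Q^n\to Q^n$ with a circuit encoding of size $\le P(n)$, represented by such circuits; a family is universal if for every finite $Q$ and polynomial $P$ it simulates $\mathcal U_{Q,P}$ in polynomial time $T$ and polynomial space $S$. $\mathcal B_{Q,\Delta}$ is the family of networks over $Q$ with a communication graph of maximum degree $\le\Delta$, represented by such a graph plus local transition tables; a family is strongly universal if for all finite $Q$ and all $\Delta\ge1$ it simulates $\mathcal B_{Q,\Delta}$ in constant time $T$ and linear space $S$. *)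

theory Defs
  imports
    Complex_Main
    "HOL-Library.FuncSet"
    "HOL-Library.Disjoint_Sets"
    "HOL-Library.Discrete_Functions"
    "HOL-Computational_Algebra.Polynomial"
    "Graph_Theory.Pair_Digraph"
    "Graph_Theory.Digraph_Component"
    "Graph_Theory.Digraph_Isomorphism"
begin

section \<open>Automata networks and their dynamics\<close>

text \<open>
  Up to renaming, \<open>Q = {0,\<dots>,q-1}\<close> and \<open>V = {0,\<dots>,n-1}\<close>; a configuration \<open>x \<in> Q\<^sup>V\<close> is the list of
  its \<open>n\<close> states. Alphabets and node sets are nonempty. The update function is extensional, so that
  equality of records is equality of networks.
\<close>

record network =
  alph :: nat
  nodes :: nat
  upd :: "nat list \<Rightarrow> nat list"

definition configs :: "network \<Rightarrow> nat list set" where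
  "configs F = {x. set x \<subseteq> {..<alph F} \<and> length x = nodes F}"

definition automata_network :: "network \<Rightarrow> bool" where
  "automata_network F \<longleftrightarrow> 0 < alph F \<and> 0 < nodes F \<and> upd F \<in> configs F \<rightarrow>\<^sub>E configs F"

definition network_power :: "network \<Rightarrow> nat \<Rightarrow> network" where
  "network_power F t = F\<lparr>upd := restrict (upd F ^^ t) (configs F)\<rparr>"

definition orbit_graph :: "network \<Rightarrow> nat list pair_pre_digraph" where
  "orbit_graph F = \<lparr>pverts = configs F, parcs = {(x, upd F x) | x. x \<in> configs F}\<rparr>"

definition transient :: "network \<Rightarrow> nat list \<Rightarrow> nat" where
  "transient F x = (LEAST \<tau>. \<exists>p\<ge>1. (upd F ^^ (\<tau> + p)) x = (upd F ^^ \<tau>) x)"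

definition period :: "network \<Rightarrow> nat list \<Rightarrow> nat" where
  "period F x = (LEAST p. 1 \<le> p \<and> (\<exists>\<tau>. (upd F ^^ (\<tau> + p)) x = (upd F ^^ \<tau>) x))"

definition periodic_orbits :: "network \<Rightarrow> nat \<Rightarrow> nat list set set" where
  "periodic_orbits F b =
     {range (\<lambda>t. (upd F ^^ t) x) | x.
        x \<in> configs F \<and> (\<exists>p\<ge>1. (upd F ^^ p) x = x) \<and> period F x \<le> b}"

lemma periodic_orbits_disjoint: "disjoint (periodic_orbits F b)"
proof -
  have sub: "range (\<lambda>t. (upd F ^^ t) x) \<subseteq> range (\<lambda>t. (upd F ^^ t) y)"
    if x: "(upd F ^^ p) x = x" "1 \<le> p" and st: "(upd F ^^ s) x = (upd F ^^ t) y" for x y p s t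
  proof -
    have per: "(upd F ^^ (p * k)) x = x" for k
      by (induction k) (simp_all add: funpow_add x(1))
    obtain d where d: "p * s = d + s"
      using x(2) by (metis add.commute le_Suc_ex mult_le_mono1 nat_mult_1)
    have "x = (upd F ^^ (d + s)) x"
      using per[of s] by (simp only: d)
    also have "\<dots> = (upd F ^^ (d + t)) y"
      by (simp only: funpow_add comp_apply st)
    finally have "(upd F ^^ r) x = (upd F ^^ (r + (d + t))) y" for r
      by (simp only: funpow_add[of r "d + t"] comp_apply)
    then show ?thesis
      by (simp add: image_subset_iff)
  qed
  have "A \<subseteq> B"
    if A: "A \<in> periodic_orbits F b" and B: "B \<in> periodic_orbits F b" and AB: "A \<inter> B \<noteq> {}" for A B
  proof -
    obtain x p where x: "A = range (\<lambda>t. (upd F ^^ t) x)" "(upd F ^^ p) x = x" "1 \<le> p"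
      using A unfolding periodic_orbits_def by blast
    obtain y where y: "B = range (\<lambda>t. (upd F ^^ t) y)"
      using B unfolding periodic_orbits_def by blast
    obtain s t where "(upd F ^^ s) x = (upd F ^^ t) y"
      using AB unfolding x(1) y by blast
    from sub[OF x(2,3) this] show ?thesis
      unfolding x(1) y .
  qed
  then show ?thesis
    unfolding disjoint_def by (metis inf.commute subset_antisym)
qed

definition embeds_with_distortion :: "(nat \<Rightarrow> nat) \<Rightarrow> network \<Rightarrow> network \<Rightarrow> bool" where
  "embeds_with_distortion \<delta> F H \<longleftrightarrow>
     nodes H \<le> \<delta> (nodes F) \<and>
     (\<exists>T \<le> \<delta> (nodes F). \<exists>K.
        subgraph K (with_proj (orbit_graph (network_power H T))) \<and>
        digraph_iso (with_proj (orbit_graph F)) K)"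


section \<open>Growth of functions\<close>

definition is_polynomial :: "(nat \<Rightarrow> nat) \<Rightarrow> bool" where
  "is_polynomial f \<longleftrightarrow> (\<exists>p :: nat poly. f = poly p)"

definition is_linear :: "(nat \<Rightarrow> nat) \<Rightarrow> bool" where
  "is_linear f \<longleftrightarrow> (\<exists>a b. f = (\<lambda>n. a * n + b))"

definition polynomially_bounded :: "(nat \<Rightarrow> nat) \<Rightarrow> bool" where
  "polynomially_bounded f \<longleftrightarrow> (\<exists>g. is_polynomial g \<and> (\<forall>n. f n \<le> g n))"

definition linearly_bounded :: "(nat \<Rightarrow> nat) \<Rightarrow> bool" where
  "linearly_bounded f \<longleftrightarrow> (\<exists>g. is_linear g \<and> (\<forall>n. f n \<le> g n))"

definition constantly_bounded :: "(nat \<Rightarrow> nat) \<Rightarrow> bool" where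
  "constantly_bounded f \<longleftrightarrow> (\<exists>c. \<forall>n. f n \<le> c)"


section \<open>Boolean circuits and circuit encodings\<close>

text \<open>
  A circuit is a straight-line program of gates of fan-in at most two. Wire \<open>i\<close> is the \<open>i\<close>-th input
  if \<open>i\<close> is less than the number of inputs, and otherwise carries the value of gate number
  \<open>i\<close> minus the number of inputs. The size is the number of vertices, inputs included.
\<close>

datatype gate = Const bool | Neg nat | Conj nat nat | Disj nat nat

record circuit =
  inputs :: nat
  gates :: "gate list"
  outputs :: "nat list"

fun gate_wires :: "gate \<Rightarrow> nat set" where
  "gate_wires (Const b) = {}"
| "gate_wires (Neg i) = {i}"
| "gate_wires (Conj i j) = {i, j}"
| "gate_wires (Disj i j) = {i, j}"

definition wf_circuit :: "circuit \<Rightarrow> bool" where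
  "wf_circuit C \<longleftrightarrow>
     (\<forall>j < length (gates C). gate_wires (gates C ! j) \<subseteq> {..<inputs C + j}) \<and>
     set (outputs C) \<subseteq> {..<inputs C + length (gates C)}"

fun gate_value :: "bool list \<Rightarrow> gate \<Rightarrow> bool" where
  "gate_value vs (Const b) = b"
| "gate_value vs (Neg i) = (\<not> vs ! i)"
| "gate_value vs (Conj i j) = (vs ! i \<and> vs ! j)"
| "gate_value vs (Disj i j) = (vs ! i \<or> vs ! j)"

definition wire_values :: "gate list \<Rightarrow> bool list \<Rightarrow> bool list" where
  "wire_values gs xs = foldl (\<lambda>vs g. vs @ [gate_value vs g]) xs gs"

definition circuit_eval :: "circuit \<Rightarrow> bool list \<Rightarrow> bool list" where
  "circuit_eval C xs = map (\<lambda>i. wire_values (gates C) xs ! i) (outputs C)"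

definition circuit_size :: "circuit \<Rightarrow> nat" where
  "circuit_size C = inputs C + length (gates C)"

text \<open>\<open>m q\<close> is the injection \<open>m\<^sub>Q\<close> fixed for the alphabet with \<open>q\<close> letters.\<close>

definition symbol_coding :: "(nat \<Rightarrow> nat \<Rightarrow> bool list) \<Rightarrow> bool" where
  "symbol_coding m \<longleftrightarrow>
     (\<forall>q. inj_on (m q) {..<q} \<and> (\<exists>k. \<forall>a<q. length (m q a) = k))"

definition config_code :: "(nat \<Rightarrow> nat \<Rightarrow> bool list) \<Rightarrow> nat \<Rightarrow> nat list \<Rightarrow> bool list" where
  "config_code m q x = concat (map (m q) x)"

text \<open>All letters have codes of the same length, so \<open>length (m q 0)\<close> is \<open>k\<^sub>Q\<close>.\<close>

definition circuit_encoding ::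
  "(nat \<Rightarrow> nat \<Rightarrow> bool list) \<Rightarrow> network \<Rightarrow> circuit \<Rightarrow> bool" where
  "circuit_encoding m F C \<longleftrightarrow>
     wf_circuit C \<and>
     inputs C = nodes F * length (m (alph F) 0) \<and>
     (\<forall>x \<in> configs F.
        circuit_eval C (config_code m (alph F) x) = config_code m (alph F) (upd F x))"

definition succinct :: "(nat \<Rightarrow> nat \<Rightarrow> bool list) \<Rightarrow> (nat \<Rightarrow> nat) \<Rightarrow> network \<Rightarrow> bool" where
  "succinct m \<rho> F \<longleftrightarrow>
     automata_network F \<and> (\<exists>C. circuit_encoding m F C \<and> circuit_size C \<le> \<rho> (nodes F))"


section \<open>Words\<close>

text \<open>
  Finite objects are written as nested lists of binary numbers (least significant bit first). The
  resulting code is prefix-free.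
\<close>

datatype sym = Zero | One | Comma | Open | Close

datatype data = Num nat | Seq "data list"

fun bin :: "nat \<Rightarrow> sym list" where
  "bin n = (if n = 0 then [] else (if even n then Zero else One) # bin (n div 2))"

declare bin.simps [simp del]

fun word_of :: "data \<Rightarrow> sym list" where
  "word_of (Num n) = bin n @ [Comma]"
| "word_of (Seq ds) = Open # concat (map word_of ds) @ [Close]"

lemma bin_0: "bin 0 = []"
  by (simp add: bin.simps[of 0])

lemma bin_pos: "0 < n \<Longrightarrow> bin n = (if even n then Zero else One) # bin (n div 2)"
  by (simp add: bin.simps[of n])

lemma bin_Comma_inject: "bin a @ Comma # u = bin b @ Comma # v \<Longrightarrow> a = b \<and> u = v"
proof (induction a arbitrary: b rule: less_induct)
  case (less a)
  show ?case
  proof (cases "a = 0 \<or> b = 0")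
    case True
    then show ?thesis
      using less.prems by (cases "a = 0"; cases "b = 0") (auto simp: bin_0 bin_pos split: if_splits)
  next
    case False
    then have "even a = even b" "bin (a div 2) @ Comma # u = bin (b div 2) @ Comma # v"
      using less.prems by (auto simp: bin_pos split: if_splits)
    moreover have "a div 2 < a"
      using False by simp
    ultimately have "even a = even b" "a div 2 = b div 2" "u = v"
      using less.IH by blast+
    then show ?thesis
      by presburger
  qed
qed

lemma bin_not_bracket: "bin n @ Comma # u \<noteq> Open # v" "bin n @ Comma # u \<noteq> Close # v"
  by (cases "n = 0"; simp add: bin_0 bin_pos)+

lemma word_of_not_Close: "word_of d @ u \<noteq> Close # v"
  by (cases d) (auto simp: bin_not_bracket)

lemma word_of_prefix_free: "word_of d @ u = word_of e @ v \<Longrightarrow> d = e \<and> u = v"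
proof (induction d arbitrary: e u v)
  case (Num n)
  then show ?case
    by (cases e) (auto dest: bin_Comma_inject simp: bin_not_bracket)
next
  case (Seq ds)
  from Seq.prems obtain es where e: "e = Seq es"
    by (cases e) (auto simp: bin_not_bracket[symmetric])
  have "ds = es \<and> u = v"
    if "concat (map word_of ds) @ Close # u = concat (map word_of es) @ Close # v"
      "set ds \<subseteq> set ds'"
      "\<And>d e u v. d \<in> set ds' \<Longrightarrow> word_of d @ u = word_of e @ v \<Longrightarrow> d = e \<and> u = v"
    for ds' ds es u v
    using that
  proof (induction ds arbitrary: es)
    case Nil
    then show ?case by (cases es) (auto simp: word_of_not_Close[symmetric])
  next
    case (Cons d ds)
    then obtain e' es' where es: "es = e' # es'"
      by (cases es) (auto simp: word_of_not_Close)
    from Cons.prems have "d = e' \<and> concat (map word_of ds) @ Close # u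
        = concat (map word_of es') @ Close # v"
      unfolding es by (auto)
    then show ?case using Cons.IH[of es'] Cons.prems es by auto
  qed
  from this[of ds u es v ds] Seq e show ?case by auto
qed

fun gate_data :: "gate \<Rightarrow> data" where
  "gate_data (Const b) = Seq [Num 0, Num (of_bool b)]"
| "gate_data (Neg i) = Seq [Num 1, Num i]"
| "gate_data (Conj i j) = Seq [Num 2, Num i, Num j]"
| "gate_data (Disj i j) = Seq [Num 3, Num i, Num j]"

definition circuit_data :: "circuit \<Rightarrow> data" where
  "circuit_data C =
     Seq [Num (inputs C), Seq (map gate_data (gates C)), Seq (map Num (outputs C))]"


section \<open>Logarithmic-space transducers\<close>

text \<open>
  A deterministic machine with a two-way read-only input tape between end markers, a one-way
  infinite work tape and a write-only output tape. Internal states and work symbols are initial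
  segments of the naturals, \<open>0\<close> being the initial state and the blank. \<open>None\<close> means halting.
\<close>

datatype cell = LeftEnd | RightEnd | Cell sym

datatype move = GoLeft | Stay | GoRight

record transducer =
  num_states :: nat
  num_work_syms :: nat
  trans :: "nat \<Rightarrow> cell \<Rightarrow> nat \<Rightarrow> (nat \<times> nat \<times> move \<times> move \<times> sym list) option"

definition wf_transducer :: "transducer \<Rightarrow> bool" where
  "wf_transducer M \<longleftrightarrow>
     0 < num_states M \<and> 0 < num_work_syms M \<and>
     (\<forall>s < num_states M. \<forall>a. \<forall>b < num_work_syms M. \<forall>s' b' di dw out.
        trans M s a b = Some (s', b', di, dw, out) \<longrightarrow>
          s' < num_states M \<and> b' < num_work_syms M)"

record machine_config =
  state :: nat
  input_pos :: nat
  work_tape :: "nat \<Rightarrow> nat"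
  work_pos :: nat
  written :: "sym list"

definition input_cell :: "sym list \<Rightarrow> nat \<Rightarrow> cell" where
  "input_cell w i =
     (if i = 0 then LeftEnd else if i \<le> length w then Cell (w ! (i - 1)) else RightEnd)"

fun move_head :: "move \<Rightarrow> nat \<Rightarrow> nat" where
  "move_head GoLeft i = i - 1"
| "move_head Stay i = i"
| "move_head GoRight i = i + 1"

definition next_action ::
  "transducer \<Rightarrow> sym list \<Rightarrow> machine_config \<Rightarrow> (nat \<times> nat \<times> move \<times> move \<times> sym list) option" where
  "next_action M w c =
     trans M (state c) (input_cell w (input_pos c)) (work_tape c (work_pos c))"

definition machine_step :: "transducer \<Rightarrow> sym list \<Rightarrow> machine_config \<Rightarrow> machine_config" where
  "machine_step M w c =
     (case next_action M w c of
        None \<Rightarrow> c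
      | Some (s', b', di, dw, out) \<Rightarrow>
          \<lparr>state = s',
           input_pos = min (move_head di (input_pos c)) (length w + 1),
           work_tape = (work_tape c)(work_pos c := b'),
           work_pos = move_head dw (work_pos c),
           written = written c @ out\<rparr>)"

definition initial_config :: machine_config where
  "initial_config =
     \<lparr>state = 0, input_pos = 0, work_tape = (\<lambda>_. 0), work_pos = 0, written = []\<rparr>"

definition computes_in_space :: "transducer \<Rightarrow> sym list \<Rightarrow> sym list \<Rightarrow> nat \<Rightarrow> bool" where
  "computes_in_space M w v s \<longleftrightarrow>
     (\<exists>t. next_action M w ((machine_step M w ^^ t) initial_config) = None \<and>
          written ((machine_step M w ^^ t) initial_config) = v \<and>
          (\<forall>i\<le>t. work_pos ((machine_step M w ^^ i) initial_config) < s))"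

definition logspace_computable :: "(sym list \<Rightarrow> sym list) \<Rightarrow> bool" where
  "logspace_computable f \<longleftrightarrow>
     (\<exists>M c. wf_transducer M \<and>
        (\<forall>w. computes_in_space M w (f w) (c * (floor_log (length w) + 1))))"


section \<open>Represented families\<close>

text \<open>
  A representation is a relation between words and networks; its domain is the representing
  language.
\<close>

type_synonym representation = "(sym list \<times> network) set"

definition standard_representation ::
  "(nat \<Rightarrow> nat \<Rightarrow> bool list) \<Rightarrow> network set \<Rightarrow> representation \<Rightarrow> bool" where
  "standard_representation m \<F> R \<longleftrightarrow>
     (\<forall>F \<in> \<F>. automata_network F) \<and> single_valued R \<and> Range R = \<F> \<and>
     (\<exists>f. logspace_computable f \<and>
        (\<forall>(w, F) \<in> R. \<exists>C. f w = word_of (circuit_data C) \<and> circuit_encoding m F C))"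

text \<open>
  The family \<open>\<U>\<^bsub>Q,P\<^esub>\<close>. The number of nodes is written next to the circuit because
  \<open>n * k\<^sub>Q\<close> inputs do not determine \<open>n\<close> when \<open>k\<^sub>Q = 0\<close>.
\<close>

definition succinct_rep ::
  "(nat \<Rightarrow> nat \<Rightarrow> bool list) \<Rightarrow> nat \<Rightarrow> (nat \<Rightarrow> nat) \<Rightarrow> representation" where
  "succinct_rep m q P =
     {(word_of (Seq [Num (nodes F), circuit_data C]), F) | F C.
        automata_network F \<and> alph F = q \<and> circuit_encoding m F C \<and>
        circuit_size C \<le> P (nodes F)}"

definition communication_graph :: "network \<Rightarrow> nat pair_pre_digraph \<Rightarrow> bool" where
  "communication_graph F E \<longleftrightarrow>
     pair_wf_digraph E \<and> pverts E = {..<nodes F} \<and>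
     (\<forall>v < nodes F. \<forall>x \<in> configs F. \<forall>y \<in> configs F.
        (\<forall>u. (u, v) \<in> parcs E \<longrightarrow> x ! u = y ! u) \<longrightarrow> upd F x ! v = upd F y ! v)"

definition max_degree_at_most :: "nat \<Rightarrow> nat pair_pre_digraph \<Rightarrow> bool" where
  "max_degree_at_most \<Delta> E \<longleftrightarrow>
     (\<forall>v \<in> pverts E. in_degree (with_proj E) v \<le> \<Delta> \<and> out_degree (with_proj E) v \<le> \<Delta>)"

definition bounded_degree :: "nat \<Rightarrow> nat \<Rightarrow> network set" where
  "bounded_degree q \<Delta> =
     {F. automata_network F \<and> alph F = q \<and>
         (\<exists>E. communication_graph F E \<and> max_degree_at_most \<Delta> E)}"

definition in_neighbours :: "nat pair_pre_digraph \<Rightarrow> nat \<Rightarrow> nat list" where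
  "in_neighbours E v = sorted_list_of_set {u. (u, v) \<in> parcs E}"

text \<open>
  For each node: the list of its in-neighbours, and the values of its local rule \<open>g v\<close> on all tuples
  of states of these, in the order of \<open>List.n_lists\<close>.
\<close>

definition local_tables_data ::
  "nat \<Rightarrow> nat \<Rightarrow> nat pair_pre_digraph \<Rightarrow> (nat \<Rightarrow> nat list \<Rightarrow> nat) \<Rightarrow> data" where
  "local_tables_data q n E g =
     Seq (map (\<lambda>v. Seq [Seq (map Num (in_neighbours E v)),
                        Seq (map (\<lambda>y. Num (g v y))
                               (List.n_lists (length (in_neighbours E v)) [0..<q]))])
            [0..<n])"

definition bounded_degree_rep :: "nat \<Rightarrow> nat \<Rightarrow> representation" where
  "bounded_degree_rep q \<Delta> =
     {(word_of (local_tables_data q (nodes F) E g), F) | F E g.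
        automata_network F \<and> alph F = q \<and>
        communication_graph F E \<and> max_degree_at_most \<Delta> E \<and>
        (\<forall>x \<in> configs F. \<forall>v < nodes F.
           upd F x ! v = g v (map (\<lambda>u. x ! u) (in_neighbours E v)))}"

lemma Range_bounded_degree_rep: "Range (bounded_degree_rep q \<Delta>) = bounded_degree q \<Delta>"
proof (intro set_eqI iffI)
  fix F assume "F \<in> bounded_degree q \<Delta>"
  then obtain E where F: "automata_network F" "alph F = q"
    and E: "communication_graph F E" "max_degree_at_most \<Delta> E"
    by (auto simp: bounded_degree_def)
  define g where "g v y = (SOME a. \<exists>x \<in> configs F.
     map (\<lambda>u. x ! u) (in_neighbours E v) = y \<and> a = upd F x ! v)" for v y
  have "{u. (u, v) \<in> parcs E} \<subseteq> {..<nodes F}" for v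
    using E(1) by (auto simp: communication_graph_def pair_wf_digraph_def)
  then have fin: "set (in_neighbours E v) = {u. (u, v) \<in> parcs E}" for v
    unfolding in_neighbours_def
    by (metis finite_lessThan finite_subset set_sorted_list_of_set)
  have "upd F x ! v = g v (map (\<lambda>u. x ! u) (in_neighbours E v))"
    if x: "x \<in> configs F" and v: "v < nodes F" for x v
  proof -
    let ?P = "\<lambda>a. \<exists>x' \<in> configs F. map (\<lambda>u. x' ! u) (in_neighbours E v)
      = map (\<lambda>u. x ! u) (in_neighbours E v) \<and> a = upd F x' ! v"
    have "?P (upd F x ! v)"
      using x by (intro bexI[of _ x]) simp_all
    from someI[of ?P, OF this] obtain x' where x': "x' \<in> configs F"
      "map (\<lambda>u. x' ! u) (in_neighbours E v) = map (\<lambda>u. x ! u) (in_neighbours E v)"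
      "g v (map (\<lambda>u. x ! u) (in_neighbours E v)) = upd F x' ! v"
      unfolding g_def by blast
    have "\<forall>u. (u, v) \<in> parcs E \<longrightarrow> x' ! u = x ! u"
      using x'(2) fin[of v] by simp
    then have "upd F x' ! v = upd F x ! v"
      using E(1) x v x'(1) unfolding communication_graph_def by blast
    with x'(3) show ?thesis
      by simp
  qed
  then show "F \<in> Range (bounded_degree_rep q \<Delta>)"
    using F E unfolding bounded_degree_rep_def Range_iff by blast
qed (auto simp: bounded_degree_rep_def bounded_degree_def)


section \<open>Simulation and universality\<close>

definition block_embedding ::
  "network \<Rightarrow> network \<Rightarrow> (nat \<Rightarrow> nat set) \<Rightarrow> (nat \<Rightarrow> nat \<Rightarrow> nat \<Rightarrow> nat) \<Rightarrow>
   (nat list \<Rightarrow> nat list) \<Rightarrow> bool" where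
  "block_embedding F G D p \<phi> \<longleftrightarrow>
     disjoint_family_on D {..<nodes F} \<and> (\<Union>i<nodes F. D i) = {..<nodes G} \<and>
     (\<forall>i < nodes F. (\<forall>a < alph F. p i a \<in> D i \<rightarrow>\<^sub>E {..<alph G}) \<and> inj_on (p i) {..<alph F}) \<and>
     (\<forall>x \<in> configs F. \<phi> x \<in> configs G \<and>
        (\<forall>i < nodes F. \<forall>v \<in> D i. \<phi> x ! v = p i (x ! i) v))"

definition block_data ::
  "network \<Rightarrow> (nat \<Rightarrow> nat set) \<Rightarrow> (nat \<Rightarrow> nat \<Rightarrow> nat \<Rightarrow> nat) \<Rightarrow> data" where
  "block_data F D p =
     Seq (map (\<lambda>i. Seq [Seq (map Num (sorted_list_of_set (D i))),
                        Seq (map (\<lambda>a. Seq (map (\<lambda>v. Num (p i a v)) (sorted_list_of_set (D i))))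
                               [0..<alph F])])
            [0..<nodes F])"

definition simulates_via ::
  "network \<Rightarrow> network \<Rightarrow> (nat list \<Rightarrow> nat list) \<Rightarrow> nat \<Rightarrow> bool" where
  "simulates_via G F \<phi> T \<longleftrightarrow> (\<forall>x \<in> configs F. \<phi> (upd F x) = (upd G ^^ T) (\<phi> x))"

text \<open>
  The machine writes the time constant, the block embedding and the word \<open>u\<close> one after the other;
  as \<open>word_of\<close> is prefix-free, the three can be read back.
\<close>

definition simulates ::
  "representation \<Rightarrow> representation \<Rightarrow> (nat \<Rightarrow> nat) \<Rightarrow> (nat \<Rightarrow> nat) \<Rightarrow> bool" where
  "simulates R R' T S \<longleftrightarrow>
     (\<exists>f. logspace_computable f \<and>
        (\<forall>(w, H) \<in> R'. \<exists>u F D p \<phi>.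
           f w = word_of (Num (T (nodes H))) @ word_of (block_data H D p) @ u \<and>
           (u, F) \<in> R \<and> nodes F = S (nodes H) \<and>
           block_embedding H F D p \<phi> \<and> simulates_via F H \<phi> (T (nodes H))))"

definition universal :: "(nat \<Rightarrow> nat \<Rightarrow> bool list) \<Rightarrow> representation \<Rightarrow> bool" where
  "universal m R \<longleftrightarrow>
     (\<forall>q\<ge>1. \<forall>P. is_polynomial P \<longrightarrow>
        (\<exists>T S. polynomially_bounded T \<and> polynomially_bounded S \<and>
               simulates R (succinct_rep m q P) T S))"

definition strongly_universal :: "representation \<Rightarrow> bool" where
  "strongly_universal R \<longleftrightarrow>
     (\<forall>q\<ge>1. \<forall>\<Delta>\<ge>1.
        (\<exists>T S. constantly_bounded T \<and> linearly_bounded S \<and>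
               simulates R (bounded_degree_rep q \<Delta>) T S))"

end

theory Submission
  imports Defs
begin

text \<open>
  A block embedding is injective and conjugates \<open>H\<close> to a power of \<open>F\<close>, so the orbit graph of \<open>H\<close>
  embeds, and \<open>F\<close> inherits the long periods and transients of \<open>H\<close> and, up to the factor \<open>T\<close>, the
  number of its fixed points. A single bounded-degree network has all three exponentially large: a
  binary counter with carries moving at unit speed, whose last node remembers the first overflow.
  Switched on, its value grows by one per step modulo \<open>2\<^sup>n\<close>; switched off, every digit sequence
  without carries is fixed. Local rules over a fixed alphabet have circuits of linear size, so the same
  counter serves both parts.
\<close>

section \<open>Growth of polynomials\<close>

text \<open>Adding one to an ordinary binary counter can change every digit at once, which no rule
  of bounded degree can do. With a third digit value a carry can be stored in transit, and the sum
  weighted by powers of two does not notice where the carries are. Orbits of small period are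
  obtained from fixed points, since the image of a fixed point returns after \<open>T\<close> steps,
  and \<open>T\<close> is within the allowed bound. All growth is measured in the size of the
  simulating network, so this size has to be controlled from both sides: from below, for arbitrarily
  large members to occur, and from above by \<open>S\<close>, for \<open>2 ^ n\<close> to remain
  large in terms of \<open>nodes F\<close>.\<close>

lemma is_polynomial_const: "is_polynomial (\<lambda>_. c)"
  unfolding is_polynomial_def by (intro exI[of _ "[:c:]"]) auto

lemma is_polynomial_ident: "is_polynomial (\<lambda>n. n)"
  unfolding is_polynomial_def by (intro exI[of _ "[:0, 1:]"]) auto

lemma is_polynomial_add:
  assumes "is_polynomial f" "is_polynomial g"
  shows "is_polynomial (\<lambda>n. f n + g n)"
proof -
  obtain p q where "f = poly p" "g = poly q"
    using assms by (auto simp: is_polynomial_def)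
  then have "(\<lambda>n. f n + g n) = poly (p + q)"
    by (simp add: fun_eq_iff)
  then show ?thesis
    by (auto simp: is_polynomial_def)
qed

lemma is_polynomial_mult:
  assumes "is_polynomial f" "is_polynomial g"
  shows "is_polynomial (\<lambda>n. f n * g n)"
proof -
  obtain p q where "f = poly p" "g = poly q"
    using assms by (auto simp: is_polynomial_def)
  then have "(\<lambda>n. f n * g n) = poly (p * q)"
    by (simp add: fun_eq_iff)
  then show ?thesis
    by (auto simp: is_polynomial_def)
qed

lemma is_polynomial_comp:
  assumes "is_polynomial f" "is_polynomial g"
  shows "is_polynomial (\<lambda>n. f (g n))"
proof -
  obtain p q where "f = poly p" "g = poly q"
    using assms by (auto simp: is_polynomial_def)
  then have "(\<lambda>n. f (g n)) = poly (pcompose p q)"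
    by (simp add: fun_eq_iff poly_pcompose)
  then show ?thesis
    by (auto simp: is_polynomial_def)
qed

lemma is_polynomial_mono:
  assumes "is_polynomial f" "a \<le> b"
  shows "f a \<le> f b"
proof -
  have "poly p a \<le> poly p b" for p :: "nat poly"
    using assms(2) by (induction p) (auto intro: mult_le_mono)
  then show ?thesis
    using assms(1) by (auto simp: is_polynomial_def)
qed

text \<open>Horner's form brings in one factor \<open>n\<close> per coefficient. Writing
  \<open>x ^ n\<close> as the square of \<open>sqrt x ^ n\<close>, one half absorbs this factor and
  the other serves the shorter polynomial, so the base has to vary in the induction.\<close>

lemma poly_times_power_tendsto_0:
  fixes p :: "nat poly" and x :: real
  assumes "0 < x" "x < 1"
  shows "(\<lambda>n. real (poly p n) * x ^ n) \<longlonglongrightarrow> 0"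
  using assms
proof (induction p arbitrary: x)
  case 0
  then show ?case by simp
next
  case (pCons a p)
  have s: "0 < sqrt x" "sqrt x < 1" "norm (sqrt x) < 1"
    using pCons.prems by auto
  have "(\<lambda>n. real a * x ^ n + (real n * sqrt x ^ n) * (real (poly p n) * sqrt x ^ n))
          \<longlonglongrightarrow> real a * 0 + 0 * 0"
    using pCons.prems s
    by (intro tendsto_add tendsto_mult tendsto_const LIMSEQ_realpow_zero powser_times_n_limit_0
          pCons.IH) auto
  moreover have "sqrt x ^ n * sqrt x ^ n = x ^ n" for n
    using pCons.prems by (simp flip: power_mult_distrib)
  then have "real a * x ^ n + (real n * sqrt x ^ n) * (real (poly p n) * sqrt x ^ n)
      = real (poly (pCons a p) n) * x ^ n" for n
    by (simp add: algebra_simps)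
  ultimately show ?case
    by simp
qed

lemma is_polynomial_less_power_2:
  assumes "is_polynomial f"
  shows "\<exists>n\<ge>N. f n < 2 ^ n"
proof -
  obtain p where f: "f = poly p"
    using assms by (auto simp: is_polynomial_def)
  have "\<forall>\<^sub>F n in sequentially. real (poly p n) * (1 / 2) ^ n < 1"
    by (rule order_tendstoD(2)[OF poly_times_power_tendsto_0]) auto
  then obtain n where n: "n \<ge> N" "real (poly p n) * (1 / 2) ^ n < 1"
    unfolding eventually_sequentially by (meson nat_le_linear)
  then have "real (poly p n) < real (2 ^ n)"
    by (simp add: field_simps)
  then show ?thesis
    using n(1) f of_nat_less_iff by blast
qed


section \<open>Orbits\<close>

lemma finite_configs: "finite (configs F)"
  unfolding configs_def using finite_lists_length_eq[of "{..<alph F}"] by simp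

lemma nth_configs_less: "x \<in> configs F \<Longrightarrow> i < nodes F \<Longrightarrow> x ! i < alph F"
  unfolding configs_def using nth_mem[of i x] by (simp add: subset_eq)

lemma length_configs: "x \<in> configs F \<Longrightarrow> length x = nodes F"
  unfolding configs_def by blast

lemma upd_in_configs: "automata_network F \<Longrightarrow> x \<in> configs F \<Longrightarrow> upd F x \<in> configs F"
  unfolding automata_network_def by blast

lemma funpow_upd_in_configs:
  "automata_network F \<Longrightarrow> x \<in> configs F \<Longrightarrow> (upd F ^^ t) x \<in> configs F"
  by (induction t) (simp_all add: upd_in_configs)

text \<open>A return persists at all later times and for all multiples of its length. Both freedoms
  are used when the time scale is stretched by \<open>T\<close>.\<close>

lemma funpow_recurrence:
  fixes f :: "'a \<Rightarrow> 'a"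
  assumes "(f ^^ (\<tau> + p)) x = (f ^^ \<tau>) x" "\<tau> \<le> s"
  shows "(f ^^ (s + p * k)) x = (f ^^ s) x"
proof (induction k)
  case (Suc k)
  obtain d where d: "s = d + \<tau>"
    using assms(2) by (metis le_Suc_ex add.commute)
  have e: "s + p * Suc k = (p * k + d) + (\<tau> + p)" "s + p * k = (p * k + d) + \<tau>"
    by (simp_all add: d)
  have "(f ^^ (s + p * Suc k)) x = (f ^^ (p * k + d)) ((f ^^ (\<tau> + p)) x)"
    unfolding e(1) funpow_add[where m = "p * k + d" and n = "\<tau> + p"] by simp
  also have "\<dots> = (f ^^ (s + p * k)) x"
    unfolding e(2) funpow_add[where m = "p * k + d" and n = \<tau>] by (simp add: assms(1))
  finally show ?case
    using Suc by simp
qed simp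

text \<open>Pigeonhole on the finitely many configurations. This makes both \<open>LEAST\<close>
  terms, in \<open>period\<close> and in \<open>transient\<close>, denote attained values.\<close>

lemma ex_recurrence:
  assumes "automata_network F" "x \<in> configs F"
  shows "\<exists>\<tau> p. 1 \<le> p \<and> (upd F ^^ (\<tau> + p)) x = (upd F ^^ \<tau>) x"
proof -
  have "range (\<lambda>t. (upd F ^^ t) x) \<subseteq> configs F"
    using funpow_upd_in_configs[OF assms] by blast
  then have "\<not> inj (\<lambda>t. (upd F ^^ t) x)"
    using finite_configs finite_subset infinite_UNIV_nat finite_imageD by metis
  then obtain s t where "(upd F ^^ s) x = (upd F ^^ t) x" "s < t"
    unfolding inj_def by (metis linorder_neqE_nat)
  then show ?thesis
    by (intro exI[of _ s] exI[of _ "t - s"]) simp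
qed

lemma period_geI:
  assumes "automata_network F" "x \<in> configs F"
    and "\<And>\<tau> p. 1 \<le> p \<Longrightarrow> (upd F ^^ (\<tau> + p)) x = (upd F ^^ \<tau>) x \<Longrightarrow> b \<le> p"
  shows "b \<le> period F x"
  unfolding period_def
  by (rule LeastI2_ex[where Q = "\<lambda>p. b \<le> p"]) (use ex_recurrence[OF assms(1,2)] assms(3) in blast)+

lemma transient_geI:
  assumes "automata_network F" "x \<in> configs F"
    and "\<And>\<tau> p. 1 \<le> p \<Longrightarrow> (upd F ^^ (\<tau> + p)) x = (upd F ^^ \<tau>) x \<Longrightarrow> b \<le> \<tau>"
  shows "b \<le> transient F x"
  unfolding transient_def
  by (rule LeastI2_ex[where Q = "\<lambda>\<tau>. b \<le> \<tau>"]) (use ex_recurrence[OF assms(1,2)] assms(3) in blast)+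

lemma finite_periodic_orbits:
  assumes "automata_network F"
  shows "finite (periodic_orbits F b)"
proof -
  have "periodic_orbits F b \<subseteq> Pow (configs F)"
    using funpow_upd_in_configs[OF assms] by (auto simp: periodic_orbits_def)
  then show ?thesis
    using finite_configs finite_subset by blast
qed

lemma range_funpow_periodic:
  assumes "(f ^^ p) x = x" "0 < p"
  shows "range (\<lambda>t. (f ^^ t) x) = (\<lambda>t. (f ^^ t) x) ` {..<p}"
proof -
  have "(f ^^ t) x = (f ^^ (t mod p)) x" for t
    by (rule funpow_mod_eq[OF assms(1), symmetric])
  then show ?thesis
    using assms(2) by (fastforce intro!: image_eqI[of _ _ "_ mod p"])
qed

section \<open>Embeddings of orbits\<close>

text \<open>What remains of a block embedding once its blocks are forgotten. The binary coding of
  configurations is another instance, and it can be composed with a simulation.\<close>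

locale orbit_embedding =
  fixes H F :: network and \<phi> :: "nat list \<Rightarrow> nat list" and T :: nat
  assumes source: "automata_network H" and target: "automata_network F"
    and inj: "inj_on \<phi> (configs H)"
    and maps: "x \<in> configs H \<Longrightarrow> \<phi> x \<in> configs F"
    and simulates: "simulates_via F H \<phi> T"
begin

lemma iterate: "x \<in> configs H \<Longrightarrow> \<phi> ((upd H ^^ t) x) = (upd F ^^ (T * t)) (\<phi> x)"
proof (induction t)
  case (Suc t)
  then show ?case
    using simulates funpow_upd_in_configs[OF source Suc.prems, of t]
    by (simp add: simulates_via_def funpow_add)
qed simp

text \<open>The return length \<open>p\<close> in \<open>F\<close> need not be a multiple of
  \<open>T\<close>. The return is still in force at the later time \<open>T * \<tau>\<close>, and
  repeating it \<open>T\<close> times gives length \<open>T * p\<close>, which \<open>\<phi>\<close>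
  reads as \<open>p\<close> steps of \<open>H\<close>. Hence periods and transients pass to
  \<open>F\<close> without loss.\<close>

lemma recurrence:
  assumes x: "x \<in> configs H" and eq: "(upd F ^^ (\<tau> + p)) (\<phi> x) = (upd F ^^ \<tau>) (\<phi> x)"
  shows "(upd H ^^ (\<tau> + p)) x = (upd H ^^ \<tau>) x"
proof -
  have "(upd F ^^ (T * (\<tau> + p))) (\<phi> x) = (upd F ^^ (T * \<tau>)) (\<phi> x)"
  \<comment> \<open>\<open>T * \<tau>\<close> is at least \<open>\<tau>\<close> only for positive
    \<open>T\<close>; for \<open>T = 0\<close> both times are 0.\<close>
  proof (cases T)
    case (Suc S)
    then have "(upd F ^^ (T * \<tau> + p * T)) (\<phi> x) = (upd F ^^ (T * \<tau>)) (\<phi> x)"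
      by (intro funpow_recurrence[OF eq]) simp
    then show ?thesis
      by (simp add: algebra_simps)
  qed simp
  then have "\<phi> ((upd H ^^ (\<tau> + p)) x) = \<phi> ((upd H ^^ \<tau>) x)"
    by (simp only: iterate[OF x])
  then show ?thesis
    using inj funpow_upd_in_configs[OF source x] by (meson inj_onD)
qed

lemma period_le:
  assumes x: "x \<in> configs H" shows "period H x \<le> period F (\<phi> x)"
proof (rule period_geI[OF target maps[OF x]])
  fix \<tau> p :: nat assume "1 \<le> p" "(upd F ^^ (\<tau> + p)) (\<phi> x) = (upd F ^^ \<tau>) (\<phi> x)"
  then show "period H x \<le> p"
    unfolding period_def using recurrence[OF x] by (intro Least_le) blast
qed

lemma transient_le:
  assumes x: "x \<in> configs H" shows "transient H x \<le> transient F (\<phi> x)"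
proof (rule transient_geI[OF target maps[OF x]])
  fix \<tau> p :: nat assume "1 \<le> p" "(upd F ^^ (\<tau> + p)) (\<phi> x) = (upd F ^^ \<tau>) (\<phi> x)"
  then show "transient H x \<le> \<tau>"
    unfolding transient_def using recurrence[OF x] by (intro Least_le) blast
qed

text \<open>\<open>simulates_via\<close> allows \<open>T = 0\<close>, but then \<open>\<phi>\<close>
  identifies each configuration with its successor, so by injectivity the source does not move at
  all.\<close>

lemma time_positive:
  assumes "x \<in> configs H" "1 < period H x" shows "0 < T"
proof (rule ccontr)
  assume "\<not> 0 < T"
  then have "\<phi> ((upd H ^^ 1) x) = \<phi> x"
    using iterate[OF assms(1), of 1] by simp
  then have "(upd H ^^ (0 + 1)) x = (upd H ^^ 0) x"
    using inj funpow_upd_in_configs[OF source assms(1), of 1] assms(1)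
    by (auto dest: inj_onD)
  then have "period H x \<le> 1"
    unfolding period_def by (intro Least_le) blast
  then show False
    using assms(2) by simp
qed

text \<open>
  Distinct fixed points may land on one orbit of \<open>F\<close>, but such an orbit has at most \<open>T\<close> points.
\<close>

lemma card_fixed_points_le:
  assumes X: "X \<subseteq> configs H" "\<And>x. x \<in> X \<Longrightarrow> upd H x = x" and T: "0 < T" "T \<le> b"
  shows "card X \<le> card (periodic_orbits F b) * T"
proof -
  define orb where "orb x = range (\<lambda>t. (upd F ^^ t) (\<phi> x))" for x
  have fixed: "(upd F ^^ T) (\<phi> x) = \<phi> x" if "x \<in> X" for x
    using iterate[of x 1] X that by auto
  have card_orb: "card (orb x) \<le> T" and fin_orb: "finite (orb x)" if "x \<in> X" for x
    unfolding orb_def range_funpow_periodic[OF fixed[OF that] T(1)]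
    using card_image_le[of "{..<T}"] by auto
  have orb: "orb x \<in> periodic_orbits F b" if x: "x \<in> X" for x
  proof -
    have "period F (\<phi> x) \<le> T"
      unfolding period_def using fixed[OF x] T by (intro Least_le) (auto intro!: exI[of _ 0])
    moreover have "\<exists>p\<ge>1. (upd F ^^ p) (\<phi> x) = \<phi> x"
      using fixed[OF x] T by (intro exI[of _ T]) auto
    ultimately show ?thesis
      unfolding periodic_orbits_def orb_def using maps[of x] X(1) x T by fastforce
  qed
  have fin: "finite (orb ` X)"
    using orb finite_periodic_orbits[OF target] finite_subset by (metis image_subsetI)
  have "card X = card (\<phi> ` X)"
    using inj X(1) by (metis card_image inj_on_subset)
  also have "\<dots> \<le> card (\<Union> (orb ` X))"
  proof (rule card_mono)
    show "finite (\<Union> (orb ` X))"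
      using fin fin_orb by blast
    show "\<phi> ` X \<subseteq> \<Union> (orb ` X)"
      unfolding orb_def using rangeI[of "\<lambda>t. (upd F ^^ t) (\<phi> _)" 0] by fastforce
  qed
  also have "\<dots> \<le> (\<Sum>A \<in> orb ` X. card A)"
    using fin_orb by (intro card_Union_le_sum_card)
  also have "\<dots> \<le> card (orb ` X) * T"
    using sum_bounded_above[of "orb ` X" card T] card_orb by auto
  also have "\<dots> \<le> card (periodic_orbits F b) * T"
    using orb finite_periodic_orbits[OF target] by (intro mult_le_mono1 card_mono) auto
  finally show ?thesis .
qed

lemma embeds_with_distortionI:
  assumes "nodes F \<le> \<delta> (nodes H)" "T \<le> \<delta> (nodes H)"
  shows "embeds_with_distortion \<delta> H F"
proof -
  let ?G = "with_proj (orbit_graph (network_power F T))" and ?GH = "with_proj (orbit_graph H)"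
  \<comment> \<open>Arcs are pairs, so \<open>\<phi>\<close> acts on them componentwise, and tail
    and head remain the two projections.\<close>
  let ?h = "\<lparr>iso_verts = \<phi>, iso_arcs = map_prod \<phi> \<phi>, iso_head = snd, iso_tail = fst\<rparr>"
  have conf: "configs (network_power F T) = configs F"
    by (simp add: network_power_def configs_def)
  have upd_T: "upd (network_power F T) x = (upd F ^^ T) x" if "x \<in> configs F" for x
    using that by (simp add: network_power_def)
  have wfG: "wf_digraph ?G"
    using funpow_upd_in_configs[OF target]
    by unfold_locales (auto simp: orbit_graph_def conf upd_T)
  have wfH: "wf_digraph ?GH"
    using upd_in_configs[OF source] by unfold_locales (auto simp: orbit_graph_def)
  have arcs: "arcs ?GH \<subseteq> configs H \<times> configs H"
    using upd_in_configs[OF source] by (auto simp: orbit_graph_def)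
  have iso: "pre_digraph.digraph_isomorphism ?GH ?h"
    unfolding pre_digraph.digraph_isomorphism_def
    using wfH inj inj_on_subset[OF map_prod_inj_on[OF inj inj] arcs]
    by (auto simp: orbit_graph_def)
  have "subgraph (app_iso ?h ?GH) ?G"
    unfolding subgraph_def
  proof (intro conjI)
    show "verts (app_iso ?h ?GH) \<subseteq> verts ?G"
      using maps by (auto simp: app_iso_def orbit_graph_def conf)
    show "arcs (app_iso ?h ?GH) \<subseteq> arcs ?G"
      using maps simulates conf
      by (auto simp: app_iso_def orbit_graph_def upd_T simulates_via_def)
    show "wf_digraph (app_iso ?h ?GH)"
      using upd_in_configs[OF source] by unfold_locales (auto simp: app_iso_def orbit_graph_def)
    show "compatible ?G (app_iso ?h ?GH)"
      by (simp add: compatible_def app_iso_def)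
  qed (fact wfG)
  then show ?thesis
    unfolding embeds_with_distortion_def digraph_iso_def using assms iso by blast
qed

end

section \<open>Orbit embeddings from codings and block embeddings\<close>

lemma orbit_embedding_comp:
  assumes "orbit_embedding G H \<psi> 1" "orbit_embedding H F \<phi> T"
  shows "orbit_embedding G F (\<phi> \<circ> \<psi>) T"
proof -
  interpret a: orbit_embedding G H \<psi> 1 by fact
  interpret b: orbit_embedding H F \<phi> T by fact
  show ?thesis
  proof
    show "inj_on (\<phi> \<circ> \<psi>) (configs G)"
      using a.maps by (intro comp_inj_on a.inj inj_on_subset[OF b.inj]) auto
    show "simulates_via F G (\<phi> \<circ> \<psi>) T"
      using a.simulates b.simulates a.maps by (auto simp: simulates_via_def)
  qed (use a.source b.target a.maps b.maps in auto)
qed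

lemma block_embedding_inj:
  assumes "block_embedding H F D p \<phi>"
  shows "inj_on \<phi> (configs H)"
proof (intro inj_onI nth_equalityI)
  fix x y assume x: "x \<in> configs H" and y: "y \<in> configs H" and eq: "\<phi> x = \<phi> y"
  show "length x = length y"
    using x y by (simp add: length_configs)
  fix i assume "i < length x"
  then have i: "i < nodes H"
    using x by (simp add: length_configs)
  \<comment> \<open>Patterns are extensional, so agreement on \<open>D i\<close> is equality of
    functions, and injectivity of \<open>p i\<close> becomes applicable.\<close>
  have ext: "p i a \<in> D i \<rightarrow>\<^sub>E {..<alph F}" if "a < alph H" for a
    using assms i that unfolding block_embedding_def by blast
  have "p i (x ! i) v = p i (y ! i) v" if "v \<in> D i" for v
    using assms x y i that eq unfolding block_embedding_def by metis
  then have "p i (x ! i) = p i (y ! i)"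
    using ext[OF nth_configs_less[OF x i]] ext[OF nth_configs_less[OF y i]]
    by (intro PiE_ext[where k = "D i"]) auto
  moreover have "inj_on (p i) {..<alph H}"
    using assms i unfolding block_embedding_def by blast
  ultimately show "x ! i = y ! i"
    using nth_configs_less[OF x i] nth_configs_less[OF y i] by (auto dest: inj_onD)
qed

text \<open>On an empty block there is only one extensional pattern, too few for two letters. So the
  blocks are nonempty and disjoint. This forces the simulating networks to be arbitrarily
  large.\<close>

lemma block_embedding_nodes_le:
  assumes "block_embedding H F D p \<phi>" "1 < alph H"
  shows "nodes H \<le> nodes F"
proof -
  have "D i \<noteq> {}" if i: "i < nodes H" for i
  proof
    assume "D i = {}"
    then have "p i 0 = p i 1"
      using assms i unfolding block_embedding_def
      by (metis PiE_empty_domain singletonD less_trans zero_less_one)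
    moreover have "inj_on (p i) {..<alph H}"
      using assms i unfolding block_embedding_def by blast
    ultimately show False
      using assms(2) by (auto dest: inj_onD)
  qed
  then have "\<forall>i. \<exists>v. i < nodes H \<longrightarrow> v \<in> D i"
    by blast
  then obtain r where r: "\<And>i. i < nodes H \<Longrightarrow> r i \<in> D i"
    by metis
  have "inj_on r {..<nodes H}"
    using r assms(1) unfolding block_embedding_def disjoint_family_on_def inj_on_def
    by (metis IntI emptyE lessThan_iff)
  moreover have "r ` {..<nodes H} \<subseteq> {..<nodes F}"
    using r assms(1) unfolding block_embedding_def by blast
  ultimately show ?thesis
    using card_inj_on_le[of r "{..<nodes H}" "{..<nodes F}"] by simp
qed

lemma simulates_orbit_embedding:
  assumes "standard_representation m \<F> R" "simulates R R' T S"
    and "H \<in> Range R'" "automata_network H"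
  obtains F \<phi> where "F \<in> \<F>" "orbit_embedding H F \<phi> (T (nodes H))" "nodes F = S (nodes H)"
    "1 < alph H \<Longrightarrow> nodes H \<le> nodes F"
proof -
  obtain w where "(w, H) \<in> R'"
    using assms(3) by blast
  with assms(2) obtain u F D p \<phi> where F: "(u, F) \<in> R" "nodes F = S (nodes H)"
      "block_embedding H F D p \<phi>" "simulates_via F H \<phi> (T (nodes H))"
    unfolding simulates_def by fast
  have mem: "F \<in> \<F>" and net: "automata_network F"
    using assms(1) F(1) unfolding standard_representation_def by blast+
  have "orbit_embedding H F \<phi> (T (nodes H))"
    using F assms(4) net block_embedding_inj[OF F(3)]
    by unfold_locales (auto simp: block_embedding_def)
  then show thesis
    using that[OF mem] F(2) block_embedding_nodes_le[OF F(3)] by blast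
qed


section \<open>A counter network\<close>

text \<open>
  Node \<open>0\<close> is constant, and a \<open>2\<close> in it feeds the nodes \<open>1,\<dots>,n\<close> with one unit per step. These hold
  the redundant binary digits \<open>0, 1, 2\<close> of a counter; a digit \<open>2\<close> becomes \<open>0\<close> and sends a carry to the
  right, so that carries travel at unit speed. Node \<open>n + 1\<close> records whether a carry has left the counter.
\<close>

definition counter_rule :: "nat \<Rightarrow> nat \<Rightarrow> nat \<Rightarrow> nat \<Rightarrow> nat" where
  "counter_rule n v a b =
     (if v = 0 then b else if v = Suc n then max b (a div 2) else b mod 2 + a div 2)"

text \<open>The nodes are the source, \<open>n\<close> digits and the overflow flag. At node 0 the
  expression \<open>v - 1\<close> is again 0, and the rule there ignores that argument.\<close>

definition counter :: "nat \<Rightarrow> network" where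
  "counter n =
     \<lparr>alph = 3, nodes = n + 2,
      upd = restrict (\<lambda>x. map (\<lambda>v. counter_rule n v (x ! (v - 1)) (x ! v)) [0..<n + 2])
              {x. set x \<subseteq> {..<3} \<and> length x = n + 2}\<rparr>"

lemma counter_simps [simp]: "alph (counter n) = 3" "nodes (counter n) = n + 2"
  by (simp_all add: counter_def)

lemma configs_counter: "configs (counter n) = {x. set x \<subseteq> {..<3} \<and> length x = n + 2}"
  by (simp add: configs_def)

lemma length_upd_counter: "x \<in> configs (counter n) \<Longrightarrow> length (upd (counter n) x) = n + 2"
  unfolding configs_counter by (simp add: counter_def)

lemma nth_upd_counter:
  "x \<in> configs (counter n) \<Longrightarrow> v < n + 2 \<Longrightarrow>
     upd (counter n) x ! v = counter_rule n v (x ! (v - 1)) (x ! v)"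
  unfolding configs_counter by (simp add: counter_def del: upt_Suc)

lemma automata_network_counter: "automata_network (counter n)"
proof -
  have "upd (counter n) x \<in> configs (counter n)" if x: "x \<in> configs (counter n)" for x
  proof -
    have rule: "counter_rule n v a b < 3" if "a < 3" "b < 3" for v a b
    proof -
      have "a div 2 \<le> 1" "b mod 2 \<le> 1"
        using that by auto
      then show ?thesis
        using that by (auto simp: counter_rule_def)
    qed
    have "upd (counter n) x ! v < 3" if "v < n + 2" for v
      unfolding nth_upd_counter[OF x that] using that nth_configs_less[OF x] by (intro rule) auto
    then show ?thesis
      unfolding configs_counter using length_upd_counter[OF x] by (auto simp: in_set_conv_nth)
  qed
  moreover have "upd (counter n) \<in> extensional (configs (counter n))"
    unfolding configs_counter by (simp add: counter_def)
  ultimately show ?thesis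
    unfolding automata_network_def by (auto simp: PiE_def)
qed

text \<open>The degree 2 counts loops: a node reads itself and its left neighbour, and is read by
  itself and its right one. At node 0 both readings are the same loop.\<close>

lemma counter_bounded_degree: "counter n \<in> bounded_degree 3 2"
proof -
  let ?E = "\<lparr>pverts = {..<n + 2}, parcs = {(u, v). v < n + 2 \<and> (u = v \<or> u = v - 1)}\<rparr>"
  have wf: "pair_wf_digraph ?E"
    by unfold_locales auto
  have local: "upd (counter n) x ! v = upd (counter n) y ! v"
    if "v < n + 2" "x \<in> configs (counter n)" "y \<in> configs (counter n)"
      "\<forall>u. (u, v) \<in> parcs ?E \<longrightarrow> x ! u = y ! u" for x y v
  proof -
    have "x ! v = y ! v" "x ! (v - 1) = y ! (v - 1)"
      using that(1,4) by auto
    then show ?thesis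
      unfolding nth_upd_counter[OF that(2,1)] nth_upd_counter[OF that(3,1)] by simp
  qed
  have "communication_graph (counter n) ?E"
    unfolding communication_graph_def
  proof (intro conjI allI impI ballI)
    fix v x y
    assume "v < nodes (counter n)" "x \<in> configs (counter n)" "y \<in> configs (counter n)"
      "\<forall>u. (u, v) \<in> parcs ?E \<longrightarrow> x ! u = y ! u"
    then show "upd (counter n) x ! v = upd (counter n) y ! v"
      unfolding counter_simps by (rule local)
  qed (use wf in simp_all)
  moreover have "max_degree_at_most 2 ?E"
    unfolding max_degree_at_most_def
  proof (intro ballI conjI)
    fix v
    have "card (in_arcs (with_proj ?E) v) \<le> card {(v, v), (v - 1, v)}"
      by (intro card_mono) (auto simp: in_arcs_def)
    also have "\<dots> \<le> 2"
      by (simp add: card_insert_if)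
    finally show "in_degree (with_proj ?E) v \<le> 2"
      unfolding in_degree_def .
    have "card (out_arcs (with_proj ?E) v) \<le> card {(v, v), (v, v + 1)}"
      by (intro card_mono) (auto simp: out_arcs_def)
    also have "\<dots> \<le> 2"
      by (simp add: card_insert_if)
    finally show "out_degree (with_proj ?E) v \<le> 2"
      unfolding out_degree_def .
  qed
  ultimately show ?thesis
    unfolding bounded_degree_def using automata_network_counter[of n] by auto
qed

section \<open>Conservation of the counted value\<close>

definition counter_value :: "nat \<Rightarrow> nat list \<Rightarrow> nat" where
  "counter_value n x = (\<Sum>i<n. 2 ^ i * x ! Suc i)"

text \<open>A carry moving one place to the right trades two units of weight \<open>2 ^ i\<close>
  for one of weight \<open>2 ^ (i + 1)\<close>, so internal carries cancel. Only the unit fed in by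
  the source and a carry leaving node \<open>n\<close> change the sum.\<close>

lemma counter_value_upd:
  assumes x: "x \<in> configs (counter n)"
  shows "counter_value n (upd (counter n) x) + 2 ^ n * (x ! n div 2)
           = counter_value n x + x ! 0 div 2"
proof -
  \<comment> \<open>The balance is proved for every prefix of \<open>k\<close> digits; the term with
    weight \<open>2 ^ k\<close> is the carry out of that prefix.\<close>
  have "(\<Sum>i<k. 2 ^ i * (x ! Suc i mod 2 + x ! i div 2)) + 2 ^ k * (x ! k div 2)
      = (\<Sum>i<k. 2 ^ i * x ! Suc i) + x ! 0 div 2" for k
  proof (induction k)
    case (Suc k)
    have "2 ^ k * (x ! Suc k mod 2) + 2 ^ Suc k * (x ! Suc k div 2) = 2 ^ k * x ! Suc k"
      unfolding power_Suc2 mult.assoc by (simp flip: distrib_left)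
    then show ?case
      using Suc by (simp add: distrib_left)
  qed simp
  moreover have "counter_value n (upd (counter n) x)
      = (\<Sum>i<n. 2 ^ i * (x ! Suc i mod 2 + x ! i div 2))"
    unfolding counter_value_def
    by (intro sum.cong) (auto simp: nth_upd_counter[OF x] counter_rule_def)
  ultimately show ?thesis
    unfolding counter_value_def by simp
qed

section \<open>The orbit of the switched-on counter\<close>

definition counter_start :: "nat \<Rightarrow> nat list" where
  "counter_start n = 2 # replicate (Suc n) 0"

context
  fixes n :: nat
begin

private definition orbit :: "nat \<Rightarrow> nat list" where
  "orbit t = (upd (counter n) ^^ t) (counter_start n)"

private lemma start_in_configs: "counter_start n \<in> configs (counter n)"
  unfolding configs_counter counter_start_def by auto

private lemma orbit_in_configs: "orbit t \<in> configs (counter n)"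
  unfolding orbit_def
  by (rule funpow_upd_in_configs[OF automata_network_counter start_in_configs])

private lemma nth_orbit_Suc:
  "v < n + 2 \<Longrightarrow> orbit (Suc t) ! v = counter_rule n v (orbit t ! (v - 1)) (orbit t ! v)"
  using nth_upd_counter[OF orbit_in_configs[of t]] by (simp add: orbit_def)

private lemma orbit_source: "orbit t ! 0 = 2"
proof (induction t)
  case 0
  then show ?case by (simp add: orbit_def counter_start_def)
next
  case (Suc t)
  then show ?case by (simp add: nth_orbit_Suc counter_rule_def)
qed

private lemma value_orbit_Suc:
  "counter_value n (orbit (Suc t)) + 2 ^ n * (orbit t ! n div 2) = counter_value n (orbit t) + 1"
  using counter_value_upd[OF orbit_in_configs[of t]] orbit_source[of t] by (simp add: orbit_def)

private lemma value_orbit_0: "counter_value n (orbit 0) = 0"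
  by (simp add: counter_value_def orbit_def counter_start_def flip: replicate_Suc)

text \<open>Redundant digits allow values above \<open>2 ^ n - 1\<close>, so the value itself need
  not be a remainder. But an escaping carry takes exactly \<open>2 ^ n\<close> with it, which is
  invisible here.\<close>

private lemma value_orbit_mod: "counter_value n (orbit t) mod 2 ^ n = t mod 2 ^ n"
proof (induction t)
  case (Suc t)
  have "counter_value n (orbit (Suc t)) mod 2 ^ n = (counter_value n (orbit t) + 1) mod 2 ^ n"
    unfolding value_orbit_Suc[symmetric] by simp
  also have "\<dots> = Suc t mod 2 ^ n"
    using Suc mod_add_cong[of "counter_value n (orbit t)" "2 ^ n" t 1 1] by simp
  finally show ?case .
qed (simp add: value_orbit_0)

lemma period_counter: "\<exists>x \<in> configs (counter n). 2 ^ n \<le> period (counter n) x"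
proof (intro bexI[of _ "counter_start n"] period_geI automata_network_counter start_in_configs)
  fix \<tau> p :: nat
  assume "1 \<le> p"
    and "(upd (counter n) ^^ (\<tau> + p)) (counter_start n) = (upd (counter n) ^^ \<tau>) (counter_start n)"
  then have "(\<tau> + p) mod 2 ^ n = \<tau> mod 2 ^ n"
    using value_orbit_mod[of "\<tau> + p"] value_orbit_mod[of \<tau>] by (simp add: orbit_def)
  then have "2 ^ n dvd p"
    by (metis add_diff_cancel_left' le_add1 mod_eq_dvd_iff_nat)
  then show "2 ^ n \<le> p"
    using \<open>1 \<le> p\<close> by (simp add: dvd_imp_le)
qed

private lemma flag_mono: "s \<le> t \<Longrightarrow> orbit s ! Suc n \<le> orbit t ! Suc n"
  by (induction rule: dec_induct) (auto simp: nth_orbit_Suc counter_rule_def)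

private lemma flag_carry: "orbit (Suc t) ! Suc n = 0 \<Longrightarrow> orbit t ! n div 2 = 0"
  by (simp add: nth_orbit_Suc counter_rule_def)

text \<open>The flag never decreases, so while it is 0 no escaping carry has been recorded and the
  value has been exact throughout.\<close>

private lemma value_orbit_eq: "orbit t ! Suc n = 0 \<Longrightarrow> counter_value n (orbit t) = t"
proof (induction t)
  case (Suc t)
  have "orbit t ! Suc n = 0"
    using flag_mono[of t "Suc t"] Suc.prems by simp
  then show ?case
    using Suc.IH value_orbit_Suc[of t] flag_carry[OF Suc.prems] by simp
qed (simp add: value_orbit_0)

text \<open>For \<open>n = 0\<close> the flag would read the source itself and be set in the first
  step.\<close>

private lemma flag_zero:
  assumes "0 < n" shows "t \<le> 2 ^ n \<Longrightarrow> orbit t ! Suc n = 0"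
proof (induction t)
  case 0
  then show ?case by (simp add: orbit_def counter_start_def flip: replicate_Suc)
next
  case (Suc t)
  obtain k where k: "n = Suc k"
    using assms gr0_conv_Suc by blast
  have flag: "orbit t ! Suc n = 0"
    using Suc by simp
  \<comment> \<open>A digit 2 in node \<open>n\<close> would weigh \<open>2 * 2 ^ k = 2 ^ n\<close>,
    more than the whole value \<open>t\<close>.\<close>
  have "2 ^ k * orbit t ! n \<le> counter_value n (orbit t)"
    by (simp add: counter_value_def k)
  also have "\<dots> < 2 ^ n"
    using value_orbit_eq[OF flag] Suc.prems by simp
  finally have "orbit t ! n div 2 = 0"
    by (simp add: k)
  then show ?case
    using flag by (simp add: nth_orbit_Suc counter_rule_def)
qed

text \<open>With the flag at 0 the value equals the time, so no configuration recurs. A recurrence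
  therefore needs a flag already set, which does not happen up to time \<open>2 ^ n\<close>.\<close>

lemma transient_counter:
  assumes "0 < n"
  shows "\<exists>x \<in> configs (counter n). 2 ^ n \<le> transient (counter n) x"
proof (intro bexI[of _ "counter_start n"] transient_geI automata_network_counter start_in_configs)
  fix \<tau> p :: nat
  assume p: "1 \<le> p"
    and eq: "(upd (counter n) ^^ (\<tau> + p)) (counter_start n)
               = (upd (counter n) ^^ \<tau>) (counter_start n)"
  have "orbit (\<tau> + p) ! Suc n \<noteq> 0"
  proof
    assume flag: "orbit (\<tau> + p) ! Suc n = 0"
    then have "orbit \<tau> ! Suc n = 0"
      using eq by (simp add: orbit_def)
    then show False
      using value_orbit_eq[OF flag] value_orbit_eq[of \<tau>] eq p by (simp add: orbit_def)
  qed
  then have "orbit \<tau> ! Suc n \<noteq> 0"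
    using eq by (simp add: orbit_def)
  then show "2 ^ n \<le> \<tau>"
    using flag_zero[OF assms] by (meson nle_le)
qed

end

lemma fixed_points_counter:
  "\<exists>X \<subseteq> configs (counter n). (\<forall>x \<in> X. upd (counter n) x = x) \<and> card X = 2 ^ (n + 2)"
\<comment> \<open>In the source both 0 and 1 mean off, and the flag is free as well; hence the
  exponent \<open>n + 2\<close>.\<close>
proof (intro exI[of _ "{x. set x \<subseteq> {0, 1} \<and> length x = n + 2}"] conjI ballI)
  let ?X = "{x :: nat list. set x \<subseteq> {0, 1} \<and> length x = n + 2}"
  show sub: "?X \<subseteq> configs (counter n)"
    unfolding configs_counter by auto
  show "card ?X = 2 ^ (n + 2)"
    using card_lists_length_eq[of "{0, 1 :: nat}" "n + 2"] by (simp add: numeral_2_eq_2)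
  fix x assume X: "x \<in> ?X"
  then have x: "x \<in> configs (counter n)"
    using sub by blast
  have bit: "x ! v = 0 \<or> x ! v = 1" if "v < n + 2" for v
    using X nth_mem[of v x] that by (auto simp: subset_eq)
  show "upd (counter n) x = x"
  proof (rule nth_equalityI)
    show "length (upd (counter n) x) = length x"
      using length_upd_counter[OF x] X by simp
    fix v assume "v < length (upd (counter n) x)"
    then have v: "v < n + 2"
      using length_upd_counter[OF x] by simp
    then have "x ! (v - 1) div 2 = 0"
      using bit[of "v - 1"] by (auto simp: less_imp_diff_less)
    then show "upd (counter n) x ! v = x ! v"
      using bit[OF v] by (auto simp: nth_upd_counter[OF x v] counter_rule_def)
  qed
qed


section \<open>Building circuits\<close>

text \<open>The gate condition of \<open>wf_circuit\<close> relative to \<open>n\<close> wires that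
  already exist, so that gate lists can be concatenated.\<close>

definition wf_gates :: "nat \<Rightarrow> gate list \<Rightarrow> bool" where
  "wf_gates n gs \<longleftrightarrow> (\<forall>j < length gs. gate_wires (gs ! j) \<subseteq> {..<n + j})"

lemma wf_gates_Nil [simp]: "wf_gates n []"
  by (simp add: wf_gates_def)

lemma wf_gates_Cons:
  "wf_gates n (g # gs) \<longleftrightarrow> gate_wires g \<subseteq> {..<n} \<and> wf_gates (Suc n) gs"
  by (simp add: wf_gates_def All_less_Suc2)

lemma wf_gates_append:
  "wf_gates n (gs @ hs) \<longleftrightarrow> wf_gates n gs \<and> wf_gates (n + length gs) hs"
  by (induction gs arbitrary: n) (auto simp: wf_gates_Cons)

lemma wire_values_Nil [simp]: "wire_values [] xs = xs"
  by (simp add: wire_values_def)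

lemma wire_values_Cons:
  "wire_values (g # gs) xs = wire_values gs (xs @ [gate_value xs g])"
  by (simp add: wire_values_def)

lemma wire_values_append: "wire_values (gs @ hs) xs = wire_values hs (wire_values gs xs)"
  by (simp add: wire_values_def)

lemma length_wire_values [simp]: "length (wire_values gs xs) = length xs + length gs"
  by (induction gs arbitrary: xs) (simp_all add: wire_values_Cons)

lemma nth_wire_values [simp]: "i < length xs \<Longrightarrow> wire_values gs xs ! i = xs ! i"
  by (induction gs arbitrary: xs) (simp_all add: wire_values_Cons nth_append)

text \<open>Shannon expansion along the first wire.\<close>

lemma boolean_function_gates:
  assumes "set ws \<subseteq> {..<n}"
  shows "\<exists>gs w. length gs + 4 \<le> 5 * 2 ^ length ws \<and> wf_gates n gs \<and> w < n + length gs \<and>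
    (\<forall>vs. length vs = n \<longrightarrow> wire_values gs vs ! w = f (map ((!) vs) ws))"
  using assms
proof (induction ws arbitrary: f n)
  case Nil
  show ?case
    by (intro exI[of _ "[Const (f [])]"] exI[of _ n])
      (simp add: wf_gates_Cons wire_values_Cons nth_append)
next
  case (Cons a ws)
  obtain gs w where gs: "length gs + 4 \<le> 5 * 2 ^ length ws" "wf_gates n gs" "w < n + length gs"
    "\<And>vs. length vs = n \<Longrightarrow> wire_values gs vs ! w = f (True # map ((!) vs) ws)"
    using Cons.IH[of n "\<lambda>bs. f (True # bs)"] Cons.prems by auto
  have "set ws \<subseteq> {..<n + length gs}"
    using Cons.prems by auto
  from Cons.IH[OF this, of "\<lambda>bs. f (False # bs)"]
  obtain hs u where hs: "length hs + 4 \<le> 5 * 2 ^ length ws" "wf_gates (n + length gs) hs"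
    "u < n + length gs + length hs"
    "\<And>vs. length vs = n + length gs \<Longrightarrow> wire_values hs vs ! u = f (False # map ((!) vs) ws)"
    by auto
  define k where "k = n + length gs + length hs"
  \<comment> \<open>Wires \<open>k\<close> to \<open>k + 3\<close> select between the two cofactors.
    The cost obeys \<open>L (r + 1) = 2 * L r + 4\<close> with \<open>L 0 = 1\<close>, that is,
    \<open>L r + 4 = 5 * 2 ^ r\<close>.\<close>
  let ?top = "[Conj a w, Neg a, Conj (Suc k) u, Disj k (Suc (Suc k))]"
  show ?case
  proof (intro exI[of _ "gs @ hs @ ?top"] exI[of _ "Suc (Suc (Suc k))"] conjI allI impI)
    show "length (gs @ hs @ ?top) + 4 \<le> 5 * 2 ^ length (a # ws)"
      using gs(1) hs(1) by simp
    show "wf_gates n (gs @ hs @ ?top)"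
      using gs(2,3) hs(2,3) Cons.prems by (auto simp: wf_gates_append wf_gates_Cons k_def)
    show "Suc (Suc (Suc k)) < n + length (gs @ hs @ ?top)"
      by (simp add: k_def)
    fix vs :: "bool list" assume vs: "length vs = n"
    define us where "us = wire_values hs (wire_values gs vs)"
    have len: "length us = k"
      by (simp add: us_def vs k_def)
    have a: "a < k" "a < n" "w < k" "u < k"
      using Cons.prems gs(3) hs(3) by (auto simp: k_def)
    have "map ((!) (wire_values gs vs)) ws = map ((!) vs) ws"
      using Cons.prems vs by auto
    then have "us ! u = f (False # map ((!) vs) ws)"
      using hs(4)[of "wire_values gs vs"] vs by (simp only: us_def length_wire_values)
    moreover have "us ! a = vs ! a" "us ! w = f (True # map ((!) vs) ws)"
      using gs(3,4) a vs by (simp_all add: us_def)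
    moreover have "wire_values (gs @ hs @ ?top) vs ! Suc (Suc (Suc k))
        = (us ! a \<and> us ! w \<or> \<not> us ! a \<and> us ! u)"
      using a len by (simp add: wire_values_append wire_values_Cons nth_append flip: us_def)
    ultimately show "wire_values (gs @ hs @ ?top) vs ! Suc (Suc (Suc k))
        = f (map ((!) vs) (a # ws))"
      by (cases "vs ! a") auto
  qed
qed

text \<open>
  The wire values \<open>e x\<close> stand for an argument \<open>x\<close>. To compute \<open>h i x\<close> from few wires it suffices that
  these wires determine it.
\<close>

lemma layer_gates:
  assumes "\<And>i. i < l \<Longrightarrow> set (ws i) \<subseteq> {..<n}" "\<And>i. i < l \<Longrightarrow> length (ws i) \<le> r"
    and "\<And>x. x \<in> A \<Longrightarrow> length (e x) = n"
    and "\<And>i x y. i < l \<Longrightarrow> x \<in> A \<Longrightarrow> y \<in> A \<Longrightarrow> \<forall>w \<in> set (ws i). e x ! w = e y ! w \<Longrightarrow> h i x = h i y"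
  shows "\<exists>gs os. length gs \<le> l * (5 * 2 ^ r) \<and> wf_gates n gs \<and> set os \<subseteq> {..<n + length gs} \<and>
    (\<forall>x \<in> A. map ((!) (wire_values gs (e x))) os = map (\<lambda>i. h i x) [0..<l])"
  using assms
proof (induction l)
  case 0
  show ?case
    by (intro exI[of _ "[]"]) simp
next
  case (Suc l)
  have "\<exists>gs os. length gs \<le> l * (5 * 2 ^ r) \<and> wf_gates n gs \<and> set os \<subseteq> {..<n + length gs} \<and>
    (\<forall>x \<in> A. map ((!) (wire_values gs (e x))) os = map (\<lambda>i. h i x) [0..<l])"
    by (rule Suc.IH) (use Suc.prems less_SucI in metis)+
  then obtain gs os where gs: "length gs \<le> l * (5 * 2 ^ r)" "wf_gates n gs"
    "set os \<subseteq> {..<n + length gs}"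
    "\<And>x. x \<in> A \<Longrightarrow> map ((!) (wire_values gs (e x))) os = map (\<lambda>i. h i x) [0..<l]"
    by blast
  \<comment> \<open>\<open>h l\<close> as a function of the bits read, evaluated at any argument
    showing these bits. By the last assumption the choice does not matter; on bit patterns that
    never occur the value is arbitrary.\<close>
  define f where "f bs = h l (SOME x. x \<in> A \<and> map ((!) (e x)) (ws l) = bs)" for bs
  have f: "f (map ((!) (e x)) (ws l)) = h l x" if x: "x \<in> A" for x
  proof -
    define y where "y = (SOME y. y \<in> A \<and> map ((!) (e y)) (ws l) = map ((!) (e x)) (ws l))"
    have "y \<in> A \<and> map ((!) (e y)) (ws l) = map ((!) (e x)) (ws l)"
      unfolding y_def by (rule someI[of _ x]) (simp add: x)
    then have "h l y = h l x"
      using x by (intro Suc.prems(4)) auto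
    then show ?thesis
      by (simp add: f_def y_def)
  qed
  have ws: "set (ws l) \<subseteq> {..<n + length gs}"
    using Suc.prems(1)[of l] by auto
  obtain hs w where hs: "length hs + 4 \<le> 5 * 2 ^ length (ws l)" "wf_gates (n + length gs) hs"
    "w < n + length gs + length hs"
    "\<And>vs. length vs = n + length gs \<Longrightarrow> wire_values hs vs ! w = f (map ((!) vs) (ws l))"
    using boolean_function_gates[OF ws, of f] by blast
  have "(2::nat) ^ length (ws l) \<le> 2 ^ r"
    using Suc.prems(2)[of l] by (intro power_increasing) auto
  then have "length hs \<le> 5 * 2 ^ r"
    using hs(1) by linarith
  then have len: "length (gs @ hs) \<le> Suc l * (5 * 2 ^ r)"
    using gs(1) by simp
  show ?case
  proof (intro exI[of _ "gs @ hs"] exI[of _ "os @ [w]"] conjI ballI)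
    show "wf_gates n (gs @ hs)"
      using gs(2) hs(2) by (simp add: wf_gates_append)
    show "set (os @ [w]) \<subseteq> {..<n + length (gs @ hs)}"
      using gs(3) hs(3) by auto
    fix x assume x: "x \<in> A"
    let ?vs = "wire_values gs (e x)"
    have vs: "length ?vs = n + length gs"
      using Suc.prems(3)[OF x] by simp
    have "map ((!) ?vs) (ws l) = map ((!) (e x)) (ws l)"
      using Suc.prems(1)[of l] Suc.prems(3)[OF x] by auto
    then have "wire_values hs ?vs ! w = h l x"
      using hs(4)[OF vs] f[OF x] by (simp only:)
    moreover have "map ((!) (wire_values hs ?vs)) os = map ((!) ?vs) os"
      using gs(3) vs by auto
    ultimately show "map ((!) (wire_values (gs @ hs) (e x))) (os @ [w]) = map (\<lambda>i. h i x) [0..<Suc l]"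
      using gs(4)[OF x] by (simp add: wire_values_append)
  qed (fact len)
qed

text \<open>
  To run a circuit with \<open>N\<close> inputs inside a larger one with \<open>n\<close> wires, feed it from the wires \<open>ins\<close>.
\<close>

fun rename_gate :: "(nat \<Rightarrow> nat) \<Rightarrow> gate \<Rightarrow> gate" where
  "rename_gate r (Const b) = Const b"
| "rename_gate r (Neg i) = Neg (r i)"
| "rename_gate r (Conj i j) = Conj (r i) (r j)"
| "rename_gate r (Disj i j) = Disj (r i) (r j)"

definition relocate :: "nat \<Rightarrow> nat list \<Rightarrow> nat \<Rightarrow> nat" where
  "relocate n ins i = (if i < length ins then ins ! i else n + (i - length ins))"

lemma relocate_less:
  "set ins \<subseteq> {..<n} \<Longrightarrow> i < length ins + j \<Longrightarrow> relocate n ins i < n + j"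
  using nth_mem[of i ins] by (auto simp: relocate_def subset_eq trans_less_add1)

lemma gate_wires_rename: "gate_wires (rename_gate r g) = r ` gate_wires g"
  by (cases g) auto

lemma gate_value_rename:
  assumes "\<And>i. i \<in> gate_wires g \<Longrightarrow> vs ! r i = us ! i"
  shows "gate_value vs (rename_gate r g) = gate_value us g"
  using assms by (cases g) auto

lemma wf_gates_relocate:
  assumes "wf_gates (length ins) gs" "set ins \<subseteq> {..<n}"
  shows "wf_gates n (map (rename_gate (relocate n ins)) gs)"
  unfolding wf_gates_def
proof (intro allI impI)
  fix j assume j: "j < length (map (rename_gate (relocate n ins)) gs)"
  then have "gate_wires (gs ! j) \<subseteq> {..<length ins + j}"
    using assms(1) by (simp add: wf_gates_def)
  then show "gate_wires (map (rename_gate (relocate n ins)) gs ! j) \<subseteq> {..<n + j}"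
    using j relocate_less[OF assms(2)] by (auto simp: gate_wires_rename)
qed

lemma wire_values_relocate:
  assumes "wf_gates (length ins) gs" "set ins \<subseteq> {..<n}" "length vs = n"
    and "i < length ins + length gs"
  shows "wire_values (map (rename_gate (relocate n ins)) gs) vs ! relocate n ins i
           = wire_values gs (map ((!) vs) ins) ! i"
  using assms(1,4)
proof (induction gs arbitrary: i rule: rev_induct)
  case Nil
  then show ?case by (simp add: relocate_def)
next
  case (snoc g gs)
  let ?r = "relocate n ins"
  let ?vs = "wire_values (map (rename_gate ?r) gs) vs" and ?us = "wire_values gs (map ((!) vs) ins)"
  have wf: "wf_gates (length ins) gs" "gate_wires g \<subseteq> {..<length ins + length gs}"
    using snoc.prems(1) by (auto simp: wf_gates_append wf_gates_Cons)
  have IH: "?vs ! ?r i = ?us ! i" if "i < length ins + length gs" for i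
    using snoc.IH[OF wf(1) that] .
  show ?case
  proof (cases "i < length ins + length gs")
    case True
    then show ?thesis
      using IH[OF True] relocate_less[OF assms(2) True] assms(3)
      by (simp add: wire_values_append wire_values_Cons nth_append)
  next
    case False
    then have i: "i = length ins + length gs"
      using snoc.prems(2) by simp
    have relocate_i: "?r (length ins + length gs) = n + length gs"
      by (simp add: relocate_def)
    have "gate_value ?vs (rename_gate ?r g) = gate_value ?us g"
      using IH wf(2) by (intro gate_value_rename) auto
    then show ?thesis
      using assms(3) relocate_i by (simp add: i wire_values_append wire_values_Cons nth_append)
  qed
qed


section \<open>Circuit encodings of networks\<close>

lemma nth_concat_blocks:
  assumes "\<And>ys. ys \<in> set xss \<Longrightarrow> length ys = k" "i < length xss" "j < k"
  shows "concat xss ! (i * k + j) = xss ! i ! j"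
  using assms
proof (induction xss arbitrary: i)
  case (Cons ys xss)
  then show ?case
    by (cases i) (auto simp: nth_append)
qed simp

lemma symbol_coding_length:
  "symbol_coding m \<Longrightarrow> a < q \<Longrightarrow> length (m q a) = length (m q 0)"
  unfolding symbol_coding_def by (metis gr_zeroI less_trans)

lemma length_config_code:
  assumes "symbol_coding m" "x \<in> configs F"
  shows "length (config_code m (alph F) x) = nodes F * length (m (alph F) 0)"
proof -
  have "length (config_code m (alph F) x) = (\<Sum>a\<leftarrow>x. length (m (alph F) 0))"
    unfolding config_code_def length_concat map_map
    using assms by (intro arg_cong[of _ _ sum_list] map_cong)
      (auto simp: configs_def intro: symbol_coding_length)
  then show ?thesis
    using assms(2) by (simp add: sum_list_triv length_configs)
qed

lemma nth_config_code:
  assumes "symbol_coding m" "x \<in> configs F" "v < nodes F" "j < length (m (alph F) 0)"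
  shows "config_code m (alph F) x ! (v * length (m (alph F) 0) + j) = m (alph F) (x ! v) ! j"
proof -
  have "concat (map (m (alph F)) x) ! (v * length (m (alph F) 0) + j)
      = map (m (alph F)) x ! v ! j"
    using assms by (intro nth_concat_blocks)
      (auto simp: configs_def intro: symbol_coding_length)
  then show ?thesis
    using assms by (simp add: config_code_def length_configs)
qed

lemma config_code_block_inj:
  assumes "symbol_coding m" "x \<in> configs F" "y \<in> configs F" "v < nodes F"
    and "\<And>j. j < length (m (alph F) 0) \<Longrightarrow>
      config_code m (alph F) x ! (v * length (m (alph F) 0) + j)
        = config_code m (alph F) y ! (v * length (m (alph F) 0) + j)"
  shows "x ! v = y ! v"
proof -
  have less: "x ! v < alph F" "y ! v < alph F"
    using assms nth_configs_less by blast+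
  have "m (alph F) (x ! v) = m (alph F) (y ! v)"
  proof (rule nth_equalityI)
    fix j assume "j < length (m (alph F) (x ! v))"
    then have j: "j < length (m (alph F) 0)"
      using symbol_coding_length[OF assms(1) less(1)] by simp
    show "m (alph F) (x ! v) ! j = m (alph F) (y ! v) ! j"
      using assms(5)[OF j] nth_config_code[OF assms(1) assms(2) assms(4) j]
        nth_config_code[OF assms(1) assms(3) assms(4) j] by simp
  qed (simp add: symbol_coding_length[OF assms(1)] less)
  then show ?thesis
    using assms(1) less by (auto simp: symbol_coding_def dest: inj_onD)
qed

lemma config_code_inj:
  assumes "symbol_coding m"
  shows "inj_on (config_code m (alph F)) (configs F)"
proof (intro inj_onI nth_equalityI)
  fix x y i
  assume x: "x \<in> configs F" and y: "y \<in> configs F"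
    and eq: "config_code m (alph F) x = config_code m (alph F) y"
  show "length x = length y"
    using x y by (simp add: length_configs)
  assume "i < length x"
  then show "x ! i = y ! i"
    using x by (intro config_code_block_inj[OF assms x y]) (simp_all add: length_configs eq)
qed

lemma div_mod_block: "(i :: nat) < n * k \<Longrightarrow> i div k < n \<and> i mod k < k"
  by (metis less_mult_imp_div_less less_nat_zero_code mod_less_divisor mult_0_right neq0_conv)

text \<open>Each output bit depends on at most \<open>\<Delta> * k\<close> input bits, so its cost
  is independent of the number of nodes.\<close>

lemma local_network_circuit:
  assumes m: "symbol_coding m" and F: "automata_network F"
    and nbr: "\<And>v. v < nodes F \<Longrightarrow> set (nbr v) \<subseteq> {..<nodes F}"
      "\<And>v. v < nodes F \<Longrightarrow> length (nbr v) \<le> \<Delta>"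
    and local: "\<And>v x y. v < nodes F \<Longrightarrow> x \<in> configs F \<Longrightarrow> y \<in> configs F \<Longrightarrow>
      \<forall>u \<in> set (nbr v). x ! u = y ! u \<Longrightarrow> upd F x ! v = upd F y ! v"
    and k: "k = length (m (alph F) 0)"
  shows "\<exists>C. circuit_encoding m F C \<and>
    circuit_size C \<le> nodes F * k + nodes F * k * (5 * 2 ^ (\<Delta> * k))"
proof -
  let ?e = "config_code m (alph F)"
  \<comment> \<open>Output bit \<open>i\<close> belongs to node \<open>i div k\<close>; it is
    computed from the complete codes of that node's neighbours.\<close>
  define ws where "ws i = concat (map (\<lambda>u. map (\<lambda>j. u * k + j) [0..<k]) (nbr (i div k)))" for i
  have "\<exists>gs os. length gs \<le> nodes F * k * (5 * 2 ^ (\<Delta> * k)) \<and> wf_gates (nodes F * k) gs \<and>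
    set os \<subseteq> {..<nodes F * k + length gs} \<and>
    (\<forall>x \<in> configs F. map ((!) (wire_values gs (?e x))) os
       = map (\<lambda>i. ?e (upd F x) ! i) [0..<nodes F * k])"
  proof (rule layer_gates[where ws = ws])
    fix i assume i: "i < nodes F * k"
    then have v: "i div k < nodes F" "i mod k < k"
      using div_mod_block by blast+
    show "set (ws i) \<subseteq> {..<nodes F * k}"
    proof
      fix w assume "w \<in> set (ws i)"
      then obtain u where u: "u \<in> set (nbr (i div k))" "w < Suc u * k"
        by (auto simp: ws_def)
      then have "Suc u \<le> nodes F"
        using nbr(1)[OF v(1)] by auto
      then have "Suc u * k \<le> nodes F * k"
        by (rule mult_le_mono1)
      then show "w \<in> {..<nodes F * k}"
        using u by simp
    qed
    show "length (ws i) \<le> \<Delta> * k"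
      using nbr(2)[OF v(1)] by (simp add: ws_def length_concat comp_def sum_list_triv)
    fix x y assume x: "x \<in> configs F" and y: "y \<in> configs F"
      and eq: "\<forall>w \<in> set (ws i). ?e x ! w = ?e y ! w"
    have "x ! u = y ! u" if u: "u \<in> set (nbr (i div k))" for u
      using eq u nbr(1)[OF v(1)]
      by (intro config_code_block_inj[OF m x y]) (auto simp: ws_def simp flip: k)
    then have "upd F x ! (i div k) = upd F y ! (i div k)"
      using local[OF v(1) x y] by blast
    then show "?e (upd F x) ! i = ?e (upd F y) ! i"
      using nth_config_code[OF m upd_in_configs[OF F x] v(1), of "i mod k"]
        nth_config_code[OF m upd_in_configs[OF F y] v(1), of "i mod k"] v(2)
      by (simp flip: k)
  qed (simp add: length_config_code[OF m] k)
  then obtain gs os where gs: "length gs \<le> nodes F * k * (5 * 2 ^ (\<Delta> * k))"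
    "wf_gates (nodes F * k) gs" "set os \<subseteq> {..<nodes F * k + length gs}"
    "\<And>x. x \<in> configs F \<Longrightarrow> map ((!) (wire_values gs (?e x))) os
       = map (\<lambda>i. ?e (upd F x) ! i) [0..<nodes F * k]"
    by blast
  let ?C = "\<lparr>inputs = nodes F * k, gates = gs, outputs = os\<rparr>"
  have "circuit_encoding m F ?C"
    unfolding circuit_encoding_def
  proof (intro conjI ballI)
    show "wf_circuit ?C"
      using gs(2,3) by (simp add: wf_circuit_def wf_gates_def)
    fix x assume x: "x \<in> configs F"
    show "circuit_eval ?C (?e x) = ?e (upd F x)"
      using gs(4)[OF x] map_nth[of "?e (upd F x)"]
      by (simp add: circuit_eval_def length_config_code[OF m upd_in_configs[OF F x]] flip: k)
  qed (simp add: k)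
  then show ?thesis
    using gs(1) by (intro exI[of _ ?C]) (simp add: circuit_size_def)
qed


section \<open>Reduction to the binary alphabet\<close>

text \<open>The circuit is run on all bit lists, including those that code no configuration, and
  thus becomes a network in its own right.\<close>

definition bit_network :: "nat \<Rightarrow> circuit \<Rightarrow> network" where
  "bit_network N C =
     \<lparr>alph = 2, nodes = N,
      upd = restrict (\<lambda>x. map of_bool (circuit_eval C (map (\<lambda>a. a = 1) x)))
              {x. set x \<subseteq> {..<2} \<and> length x = N}\<rparr>"

lemma bit_network_simps [simp]: "alph (bit_network N C) = 2" "nodes (bit_network N C) = N"
  by (simp_all add: bit_network_def)

lemma configs_bit_network: "configs (bit_network N C) = {x. set x \<subseteq> {..<2} \<and> length x = N}"
  by (simp add: configs_def)

lemma upd_bit_network: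
  "x \<in> configs (bit_network N C) \<Longrightarrow>
     upd (bit_network N C) x = map of_bool (circuit_eval C (map (\<lambda>a. a = 1) x))"
  unfolding configs_bit_network by (simp add: bit_network_def)

lemma bits_in_configs: "length bs = N \<Longrightarrow> map of_bool bs \<in> configs (bit_network N C)"
  unfolding configs_bit_network by auto

lemma automata_network_bit_network:
  assumes "0 < N" "length (outputs C) = N"
  shows "automata_network (bit_network N C)"
proof -
  have "upd (bit_network N C) \<in> extensional (configs (bit_network N C))"
    unfolding configs_bit_network by (simp add: bit_network_def)
  moreover have "upd (bit_network N C) x \<in> configs (bit_network N C)"
    if "x \<in> configs (bit_network N C)" for x
    unfolding upd_bit_network[OF that] using assms(2)
    by (intro bits_in_configs) (simp add: circuit_eval_def)
  ultimately show ?thesis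
    using assms(1) by (auto simp: automata_network_def PiE_def)
qed

text \<open>Even the letters 0 and 1 are coded by the prescribed \<open>m 2\<close>. The four
  summands are the inputs, a decoder reading \<open>k\<close> wires per cell, the circuit
  \<open>C\<close> itself, and an encoder computing each code bit from a single wire.\<close>

lemma bit_network_circuit:
  assumes m: "symbol_coding m" and k: "k = length (m 2 0)"
    and C: "wf_circuit C" "inputs C = N" "length (outputs C) = N" and N: "0 < N"
  shows "\<exists>D. circuit_encoding m (bit_network N C) D \<and>
    circuit_size D \<le> N * k + N * (5 * 2 ^ k) + length (gates C) + N * k * (5 * 2 ^ 1)"
proof -
  let ?B = "bit_network N C" and ?e = "config_code m 2"
  note B = automata_network_bit_network[OF N C(3)]
  have len_e: "length (?e x) = N * k" if "x \<in> configs ?B" for x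
    using length_config_code[OF m that] by (simp add: k)
  have nth_e: "?e x ! (i * k + j) = m 2 (x ! i) ! j" if "x \<in> configs ?B" "i < N" "j < k" for x i j
    using nth_config_code[OF m that(1), of i j] that by (simp add: k)
  have "\<exists>gs ins. length gs \<le> N * (5 * 2 ^ k) \<and> wf_gates (N * k) gs \<and>
      set ins \<subseteq> {..<N * k + length gs} \<and>
      (\<forall>x \<in> configs ?B. map ((!) (wire_values gs (?e x))) ins = map (\<lambda>i. x ! i = 1) [0..<N])"
  proof (rule layer_gates[where ws = "\<lambda>i. map (\<lambda>j. i * k + j) [0..<k]"])
    fix i assume i: "i < N"
    then have "Suc i * k \<le> N * k"
      by (intro mult_le_mono1) simp
    then show "set (map (\<lambda>j. i * k + j) [0..<k]) \<subseteq> {..<N * k}"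
      by auto
    fix x y assume x: "x \<in> configs ?B" and y: "y \<in> configs ?B"
      and eq: "\<forall>w \<in> set (map (\<lambda>j. i * k + j) [0..<k]). ?e x ! w = ?e y ! w"
    have "x ! i = y ! i"
      using config_code_block_inj[OF m x y, of i] eq i by (simp flip: k)
    then show "(x ! i = 1) = (y ! i = 1)"
      by simp
  qed (simp_all add: len_e)
  then obtain gs ins where gs: "length gs \<le> N * (5 * 2 ^ k)" "wf_gates (N * k) gs"
    "set ins \<subseteq> {..<N * k + length gs}"
    "\<And>x. x \<in> configs ?B \<Longrightarrow> map ((!) (wire_values gs (?e x))) ins = map (\<lambda>i. x ! i = 1) [0..<N]"
    by blast
  \<comment> \<open>The number of decoder outputs is known only through their values, so some
    configuration is needed to read it off.\<close>
  have "map of_bool (replicate N False) \<in> configs ?B"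
    by (intro bits_in_configs) simp
  from arg_cong[OF gs(4)[OF this], of length] have len_ins: "length ins = N"
    by simp
  define n1 where "n1 = N * k + length gs"
  define hs where "hs = map (rename_gate (relocate n1 ins)) (gates C)"
  define n2 where "n2 = n1 + length hs"
  define outs where "outs = map (relocate n1 ins) (outputs C)"
  have wfC: "wf_gates (length ins) (gates C)" "set (outputs C) \<subseteq> {..<length ins + length (gates C)}"
    using C(1,2) by (auto simp: wf_circuit_def wf_gates_def len_ins)
  have ins: "set ins \<subseteq> {..<n1}"
    using gs(3) by (simp add: n1_def)
  have wf_hs: "wf_gates n1 hs"
    unfolding hs_def by (rule wf_gates_relocate[OF wfC(1) ins])
  have outs: "outs ! i < n2" if "i < N" for i
    using that wfC(2) C(3) relocate_less[OF ins, of "outputs C ! i" "length (gates C)"]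
    by (auto simp: outs_def n2_def hs_def subset_eq)
  define val where "val x = wire_values hs (wire_values gs (?e x))" for x
  have val: "val x ! (outs ! i) = (upd ?B x ! i = 1)" if x: "x \<in> configs ?B" and i: "i < N" for x i
  proof -
    have len: "length (wire_values gs (?e x)) = n1"
      by (simp add: len_e[OF x] n1_def)
    have "outputs C ! i < length ins + length (gates C)"
      using wfC(2) i C(3) by (auto simp: subset_eq)
    from wire_values_relocate[OF wfC(1) ins len this]
    have "val x ! (outs ! i)
        = wire_values (gates C) (map ((!) (wire_values gs (?e x))) ins) ! (outputs C ! i)"
      using i C(3) by (simp add: val_def hs_def outs_def)
    also have "map ((!) (wire_values gs (?e x))) ins = map (\<lambda>a. a = 1) x"
      unfolding gs(4)[OF x] using length_configs[OF x] by (intro nth_equalityI) auto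
    also have "wire_values (gates C) (map (\<lambda>a. a = 1) x) ! (outputs C ! i) = (upd ?B x ! i = 1)"
      using i C(3) by (simp add: upd_bit_network[OF x] circuit_eval_def)
    finally show ?thesis .
  qed
  have "\<exists>fs os. length fs \<le> N * k * (5 * 2 ^ 1) \<and> wf_gates n2 fs \<and>
      set os \<subseteq> {..<n2 + length fs} \<and>
      (\<forall>x \<in> configs ?B. map ((!) (wire_values fs (val x))) os
         = map (\<lambda>i. ?e (upd ?B x) ! i) [0..<N * k])"
  proof (rule layer_gates[where ws = "\<lambda>i. [outs ! (i div k)]"])
    fix i assume "i < N * k"
    then have v: "i div k < N" "i mod k < k"
      using div_mod_block by blast+
    show "set [outs ! (i div k)] \<subseteq> {..<n2}"
      using outs[OF v(1)] by simp
    fix x y assume x: "x \<in> configs ?B" and y: "y \<in> configs ?B"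
      and eq: "\<forall>w \<in> set [outs ! (i div k)]. val x ! w = val y ! w"
    note ux = upd_in_configs[OF B x] and uy = upd_in_configs[OF B y]
    have "upd ?B x ! (i div k) < 2" "upd ?B y ! (i div k) < 2"
      using nth_configs_less[OF ux] nth_configs_less[OF uy] v(1) by auto
    moreover have "(upd ?B x ! (i div k) = 1) = (upd ?B y ! (i div k) = 1)"
      using eq val[OF x v(1)] val[OF y v(1)] by simp
    ultimately have "upd ?B x ! (i div k) = upd ?B y ! (i div k)"
      by linarith
    then show "?e (upd ?B x) ! i = ?e (upd ?B y) ! i"
      using nth_e[OF ux v] nth_e[OF uy v] by simp
  qed (simp_all add: val_def len_e n1_def n2_def)
  then obtain fs os where fs: "length fs \<le> N * k * (5 * 2 ^ 1)" "wf_gates n2 fs"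
    "set os \<subseteq> {..<n2 + length fs}"
    "\<And>x. x \<in> configs ?B \<Longrightarrow> map ((!) (wire_values fs (val x))) os
       = map (\<lambda>i. ?e (upd ?B x) ! i) [0..<N * k]"
    by blast
  let ?D = "\<lparr>inputs = N * k, gates = gs @ hs @ fs, outputs = os\<rparr>"
  have "wf_gates (N * k) (gs @ hs @ fs)"
    using gs(2) wf_hs fs(2) by (simp add: wf_gates_append n1_def n2_def add.assoc)
  moreover have "set os \<subseteq> {..<N * k + length (gs @ hs @ fs)}"
    using fs(3) by (simp add: n1_def n2_def add.assoc)
  ultimately have "wf_circuit ?D"
    by (simp add: wf_circuit_def wf_gates_def)
  moreover have "circuit_eval ?D (?e x) = ?e (upd ?B x)" if x: "x \<in> configs ?B" for x
    using fs(4)[OF x] map_nth[of "?e (upd ?B x)"]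
    by (simp add: circuit_eval_def wire_values_append len_e[OF upd_in_configs[OF B x]]
          flip: val_def)
  ultimately have "circuit_encoding m ?B ?D"
    by (simp add: circuit_encoding_def k)
  then show ?thesis
    using gs(1) fs(1) by (intro exI[of _ ?D]) (simp add: circuit_size_def hs_def)
qed

lemma orbit_embedding_bit_network:
  assumes m: "symbol_coding m" and H: "automata_network H" and C: "circuit_encoding m H C"
    and N: "N = nodes H * length (m (alph H) 0)" "0 < N"
  shows "length (outputs C) = N"
    and "orbit_embedding H (bit_network N C) (\<lambda>x. map of_bool (config_code m (alph H) x)) 1"
proof -
  let ?e = "config_code m (alph H)"
  have len: "length (?e x) = N" if "x \<in> configs H" for x
    using length_config_code[OF m that] N(1) by simp
  have eval: "circuit_eval C (?e x) = ?e (upd H x)" if "x \<in> configs H" for x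
    using C that by (simp add: circuit_encoding_def)
  \<comment> \<open>\<open>circuit_encoding\<close> fixes the number of outputs only through
    evaluation, here at one concrete configuration.\<close>
  have "replicate (nodes H) 0 \<in> configs H"
    using H by (auto simp: configs_def automata_network_def)
  then show out: "length (outputs C) = N"
    using len upd_in_configs[OF H] eval unfolding circuit_eval_def by (metis length_map)
  show "orbit_embedding H (bit_network N C) (\<lambda>x. map of_bool (?e x)) 1"
  proof
    show "automata_network (bit_network N C)"
      by (rule automata_network_bit_network[OF N(2) out])
    have "inj (map (of_bool :: bool \<Rightarrow> nat))"
      by (intro injI map_injective[of of_bool]) (auto simp: inj_def)
    then have "inj_on (map of_bool \<circ> ?e :: _ \<Rightarrow> nat list) (configs H)"
      by (intro comp_inj_on config_code_inj[OF m]) (auto intro: inj_on_subset)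
    then show "inj_on (\<lambda>x. map of_bool (?e x) :: nat list) (configs H)"
      by (simp add: comp_def)
    show "map of_bool (?e x) \<in> configs (bit_network N C)" if "x \<in> configs H" for x
      by (intro bits_in_configs len that)
    then show "simulates_via (bit_network N C) H (\<lambda>x. map of_bool (?e x)) 1"
      by (simp add: simulates_via_def upd_bit_network eval comp_def)
  qed (fact H)
qed


section \<open>Transfer to universal families\<close>

lemma counter_in_succinct_rep:
  assumes m: "symbol_coding m"
  shows "\<exists>P. is_polynomial P \<and> (\<forall>n. counter n \<in> Range (succinct_rep m 3 P))"
proof -
  define k where "k = length (m 3 0)"
  define P where "P = (\<lambda>N. N * k + N * k * (5 * 2 ^ (2 * k)))"
  have "counter n \<in> Range (succinct_rep m 3 P)" for n
  proof -
    have "\<exists>C. circuit_encoding m (counter n) C \<and> circuit_size C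
        \<le> nodes (counter n) * k + nodes (counter n) * k * (5 * 2 ^ (2 * k))"
    proof (rule local_network_circuit[OF m automata_network_counter, where nbr = "\<lambda>v. [v - 1, v]"])
      fix v x y
      assume "v < nodes (counter n)" "x \<in> configs (counter n)" "y \<in> configs (counter n)"
        "\<forall>u \<in> set [v - 1, v]. x ! u = y ! u"
      then show "upd (counter n) x ! v = upd (counter n) y ! v"
        using nth_upd_counter[of x n v] nth_upd_counter[of y n v] by simp
    qed (simp_all add: k_def)
    then show ?thesis
      unfolding succinct_rep_def P_def using automata_network_counter[of n] counter_simps(1)[of n]
      by blast
  qed
  moreover have "is_polynomial P"
    unfolding P_def
    by (intro is_polynomial_add is_polynomial_mult is_polynomial_ident is_polynomial_const)
  ultimately show ?thesis
    by blast
qed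

lemma orbit_embedding_counter:
  assumes "orbit_embedding (counter n) F \<phi> T" "0 < n" "T \<le> b"
  shows "\<exists>x \<in> configs F. 2 ^ n \<le> period F x"
    and "\<exists>x \<in> configs F. 2 ^ n \<le> transient F x"
    and "2 ^ (n + 2) \<le> card (periodic_orbits F b) * T"
proof -
  interpret orbit_embedding "counter n" F \<phi> T by fact
  obtain x where x: "x \<in> configs (counter n)" "2 ^ n \<le> period (counter n) x"
    using period_counter by blast
  then show "\<exists>x \<in> configs F. 2 ^ n \<le> period F x"
    using maps period_le order_trans by blast
  obtain y where "y \<in> configs (counter n)" "2 ^ n \<le> transient (counter n) y"
    using transient_counter[OF assms(2)] by blast
  then show "\<exists>x \<in> configs F. 2 ^ n \<le> transient F x"
    using maps transient_le order_trans by blast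
  \<comment> \<open>A period of at least 2 excludes \<open>T = 0\<close>.\<close>
  have "(2::nat) ^ 1 \<le> 2 ^ n"
    using assms(2) by (intro power_increasing) auto
  then have "0 < T"
    using x by (intro time_positive[of x]) auto
  moreover obtain X where "X \<subseteq> configs (counter n)" "\<forall>x \<in> X. upd (counter n) x = x"
      "card X = 2 ^ (n + 2)"
    using fixed_points_counter by blast
  ultimately show "2 ^ (n + 2) \<le> card (periodic_orbits F b) * T"
    using card_fixed_points_le[of X b] assms(3) by simp
qed

text \<open>
  Universality fixes the alphabet, but the distortion must serve all alphabets at once; hence the
  detour through networks of bits.
\<close>

lemma universal_embeds_succinct:
  assumes m: "symbol_coding m" and std: "standard_representation m \<F> R" and univ: "universal m R"
    and \<rho>: "is_polynomial \<rho>"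
  shows "\<exists>\<delta>. is_polynomial \<delta> \<and>
    (\<forall>H. succinct m \<rho> H \<longrightarrow> (\<exists>F \<in> \<F>. embeds_with_distortion \<delta> H F))"
proof -
  define k where "k = length (m 2 0)"
  define P where "P = (\<lambda>N. N * k + N * (5 * 2 ^ k) + \<rho> N + N * k * (5 * 2 ^ 1))"
  have P: "is_polynomial P"
    unfolding P_def
    by (intro is_polynomial_add is_polynomial_mult is_polynomial_ident is_polynomial_const \<rho>)
  obtain T1 S1 where "polynomially_bounded T1" "polynomially_bounded S1"
    and sim1: "simulates R (succinct_rep m 1 \<rho>) T1 S1"
    using univ \<rho> unfolding universal_def by blast
  then obtain t1 s1 where poly1: "is_polynomial t1" "is_polynomial s1"
    and le1: "\<And>n. T1 n \<le> t1 n" "\<And>n. S1 n \<le> s1 n"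
    unfolding polynomially_bounded_def by blast
  have "(1::nat) \<le> 2"
    by simp
  then obtain T2 S2 where "polynomially_bounded T2" "polynomially_bounded S2"
    and sim2: "simulates R (succinct_rep m 2 P) T2 S2"
    using univ P unfolding universal_def by blast
  then obtain t2 s2 where poly2: "is_polynomial t2" "is_polynomial s2"
    and le2: "\<And>n. T2 n \<le> t2 n" "\<And>n. S2 n \<le> s2 n"
    unfolding polynomially_bounded_def by blast
  \<comment> \<open>The bit network has at most \<open>\<rho> (nodes H)\<close> cells because the
    circuit size counts the inputs. The summands \<open>t1\<close> and \<open>s1\<close> serve the
    alphabet with one letter.\<close>
  define \<delta> where "\<delta> = (\<lambda>n. t1 n + s1 n + (t2 (\<rho> n) + s2 (\<rho> n)))"
  have "\<exists>F \<in> \<F>. embeds_with_distortion \<delta> H F" if "succinct m \<rho> H" for H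
  proof -
    obtain C where H: "automata_network H" and C: "circuit_encoding m H C"
        "circuit_size C \<le> \<rho> (nodes H)"
      using \<open>succinct m \<rho> H\<close> unfolding succinct_def by blast
    have pos: "0 < nodes H" "0 < alph H"
      using H by (auto simp: automata_network_def)
    define N where "N = nodes H * length (m (alph H) 0)"
    show ?thesis
    \<comment> \<open>Empty codes leave room for one letter only. The bit network would have no
      nodes, so \<open>H\<close> is then simulated directly.\<close>
    proof (cases "N = 0")
      case True
      then have "length (m (alph H) 0) = 0"
        using pos by (simp add: N_def)
      have "alph H = 1"
      proof (rule ccontr)
        assume "alph H \<noteq> 1"
        then have "1 < alph H"
          using pos by simp
        then have "m (alph H) 0 = m (alph H) 1"
          using symbol_coding_length[OF m, of 1 "alph H"] \<open>length (m (alph H) 0) = 0\<close> by simp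
        then show False
          using m \<open>1 < alph H\<close> inj_onD[of "m (alph H)" "{..<alph H}" 0 1]
          by (auto simp: symbol_coding_def)
      qed
      then have "H \<in> Range (succinct_rep m 1 \<rho>)"
        unfolding succinct_rep_def using H C by blast
      from simulates_orbit_embedding[OF std sim1 this H]
      obtain F \<phi> where F: "F \<in> \<F>" "orbit_embedding H F \<phi> (T1 (nodes H))" "nodes F = S1 (nodes H)"
        by blast
      have "embeds_with_distortion \<delta> H F"
        using le1[of "nodes H"] F(3)
        by (intro orbit_embedding.embeds_with_distortionI[OF F(2)]) (auto simp: \<delta>_def)
      then show ?thesis
        using F(1) by blast
    next
      case False
      then have N: "0 < N"
        by simp
      let ?B = "bit_network N C"
      note outs = orbit_embedding_bit_network(1)[OF m H C(1) N_def N]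
        and emb = orbit_embedding_bit_network(2)[OF m H C(1) N_def N]
      note B = automata_network_bit_network[OF N outs]
      have wf: "wf_circuit C" "inputs C = N"
        using C(1) by (auto simp: circuit_encoding_def N_def)
      obtain D where D: "circuit_encoding m ?B D"
          "circuit_size D \<le> N * k + N * (5 * 2 ^ k) + length (gates C) + N * k * (5 * 2 ^ 1)"
        using bit_network_circuit[OF m k_def wf outs N] by blast
      have "nodes H \<le> N"
        using N by (simp add: N_def Suc_le_eq)
      then have "length (gates C) \<le> \<rho> N"
        using C(2) is_polynomial_mono[OF \<rho>, of "nodes H" N] by (simp add: circuit_size_def)
      then have "circuit_size D \<le> P (nodes ?B)"
        using D(2) by (simp add: P_def)
      then have "?B \<in> Range (succinct_rep m 2 P)"
        unfolding succinct_rep_def using B D(1) bit_network_simps(1)[of N C] by blast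
      from simulates_orbit_embedding[OF std sim2 this B]
      obtain F \<phi> where F: "F \<in> \<F>" "orbit_embedding ?B F \<phi> (T2 N)" "nodes F = S2 N"
        unfolding bit_network_simps by blast
      have "N \<le> \<rho> (nodes H)"
        using C(2) wf(2) by (simp add: circuit_size_def)
      then have "t2 N \<le> t2 (\<rho> (nodes H))" "s2 N \<le> s2 (\<rho> (nodes H))"
        using is_polynomial_mono poly2 by blast+
      then have "embeds_with_distortion \<delta> H F"
        using le2[of N] F(3)
        by (intro orbit_embedding.embeds_with_distortionI[OF orbit_embedding_comp[OF emb F(2)]])
          (auto simp: \<delta>_def)
      then show ?thesis
        using F(1) by blast
    qed
  qed
  moreover have "is_polynomial \<delta>"
    unfolding \<delta>_def by (intro is_polynomial_add is_polynomial_comp[OF _ \<rho>] poly1 poly2)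
  ultimately show ?thesis
    by blast
qed

text \<open>The bound on the short periods has to be chosen before \<open>P\<close>; it is the
  polynomial bounding the time constants for the counters.\<close>

lemma universal_rich_dynamics:
  assumes m: "symbol_coding m" and std: "standard_representation m \<F> R" and univ: "universal m R"
  shows "\<exists>\<pi>. is_polynomial \<pi> \<and>
    (\<forall>P. is_polynomial P \<longrightarrow>
       (\<forall>N. \<exists>F \<in> \<F>. N \<le> nodes F \<and>
          (\<exists>x \<in> configs F. P (nodes F) < period F x) \<and>
          (\<exists>x \<in> configs F. P (nodes F) < transient F x) \<and>
          P (nodes F) < card (periodic_orbits F (\<pi> (nodes F)))))"
proof -
  obtain P0 where "is_polynomial P0" and counter: "\<And>n. counter n \<in> Range (succinct_rep m 3 P0)"
    using counter_in_succinct_rep[OF m] by blast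
  moreover have "(1::nat) \<le> 3"
    by simp
  ultimately obtain T S where "polynomially_bounded T" "polynomially_bounded S"
    and sim: "simulates R (succinct_rep m 3 P0) T S"
    using univ unfolding universal_def by blast
  then obtain t s where poly: "is_polynomial t" "is_polynomial s"
    and le: "\<And>n. T n \<le> t n" "\<And>n. S n \<le> s n"
    unfolding polynomially_bounded_def by blast
  have "\<exists>F \<in> \<F>. N \<le> nodes F \<and>
      (\<exists>x \<in> configs F. P (nodes F) < period F x) \<and>
      (\<exists>x \<in> configs F. P (nodes F) < transient F x) \<and>
      P (nodes F) < card (periodic_orbits F (t (nodes F)))" if P: "is_polynomial P" for P N
  proof -
    \<comment> \<open>The second summand dominates \<open>P (nodes F)\<close> for periods and
      transients. The first one covers the loss of the factor \<open>T\<close> when fixed points are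
      grouped into orbits.\<close>
    have "is_polynomial (\<lambda>n. P (s (n + 2)) * t (n + 2) + P (s (n + 2)))"
      by (intro is_polynomial_add is_polynomial_mult is_polynomial_comp[OF P]
            is_polynomial_comp[OF poly(1)] is_polynomial_comp[OF poly(2)]
            is_polynomial_ident is_polynomial_const)
    from is_polynomial_less_power_2[OF this, of "N + 1"] obtain n where n: "N + 1 \<le> n"
      "P (s (n + 2)) * t (n + 2) + P (s (n + 2)) < 2 ^ n"
      by blast
    obtain F \<phi> where F: "F \<in> \<F>" "orbit_embedding (counter n) F \<phi> (T (n + 2))"
      "nodes F = S (n + 2)" "n + 2 \<le> nodes F"
      using simulates_orbit_embedding[OF std sim counter automata_network_counter, of n] by auto
    \<comment> \<open>The period bound has to be expressed in the size of \<open>F\<close>, which is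
      at least that of the counter.\<close>
    have "T (n + 2) \<le> t (nodes F)"
      using le(1)[of "n + 2"] is_polynomial_mono[OF poly(1) F(4)] by simp
    note big = orbit_embedding_counter[OF F(2) _ this]
    have P_le: "P (nodes F) \<le> P (s (n + 2))"
      unfolding F(3) by (rule is_polynomial_mono[OF P le(2)])
    have "P (nodes F) < card (periodic_orbits F (t (nodes F)))"
    proof (rule ccontr)
      assume "\<not> ?thesis"
      then have "card (periodic_orbits F (t (nodes F))) * T (n + 2) \<le> P (s (n + 2)) * t (n + 2)"
        using P_le le(1) by (intro mult_le_mono) auto
      also have "\<dots> < 2 ^ n"
        using n(2) by simp
      also have "\<dots> \<le> 2 ^ (n + 2)"
        by simp
      finally show False
        using big(3) n(1) by simp
    qed
    moreover have "P (nodes F) < 2 ^ n"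
      using P_le n(2) by simp
    ultimately show ?thesis
      using F(1,4) n(1) big(1,2) by (intro bexI[of _ F]) (auto intro: less_le_trans)
  qed
  then show ?thesis
    using poly(1) by blast
qed

section \<open>Strongly universal families\<close>

lemma strongly_universal_embeds_bounded_degree:
  assumes std: "standard_representation m \<F> R" and univ: "strongly_universal R"
    and "1 \<le> q" "1 \<le> \<Delta>"
  shows "\<exists>\<delta>. is_linear \<delta> \<and> (\<forall>H \<in> bounded_degree q \<Delta>. \<exists>F \<in> \<F>. embeds_with_distortion \<delta> H F)"
proof -
  obtain T S where "constantly_bounded T" "linearly_bounded S"
    and sim: "simulates R (bounded_degree_rep q \<Delta>) T S"
    using univ assms(3,4) unfolding strongly_universal_def by blast
  then obtain t a b where le: "\<And>n. T n \<le> t" "\<And>n. S n \<le> a * n + b"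
    unfolding constantly_bounded_def linearly_bounded_def is_linear_def by blast
  define \<delta> where "\<delta> = (\<lambda>n. a * n + (b + t))"
  have "\<exists>F \<in> \<F>. embeds_with_distortion \<delta> H F" if H: "H \<in> bounded_degree q \<Delta>" for H
  proof -
    have "H \<in> Range (bounded_degree_rep q \<Delta>)" "automata_network H"
      using H Range_bounded_degree_rep by (auto simp: bounded_degree_def)
    from simulates_orbit_embedding[OF std sim this]
    obtain F \<phi> where F: "F \<in> \<F>" "orbit_embedding H F \<phi> (T (nodes H))" "nodes F = S (nodes H)"
      by blast
    have "embeds_with_distortion \<delta> H F"
      using le(1)[of "nodes H"] le(2)[of "nodes H"] F(3)
      by (intro orbit_embedding.embeds_with_distortionI[OF F(2)]) (auto simp: \<delta>_def)
    then show ?thesis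
      using F(1) by blast
  qed
  then show ?thesis
    unfolding is_linear_def \<delta>_def by blast
qed

lemma strongly_universal_rich_dynamics:
  assumes std: "standard_representation m \<F> R" and univ: "strongly_universal R"
  shows "\<exists>c > (1::real). \<exists>\<pi>. is_linear \<pi> \<and>
    (\<forall>N. \<exists>F \<in> \<F>. N \<le> nodes F \<and>
       (\<exists>x \<in> configs F. c ^ nodes F \<le> real (period F x)) \<and>
       (\<exists>x \<in> configs F. c ^ nodes F \<le> real (transient F x)) \<and>
       c ^ nodes F \<le> real (card (periodic_orbits F (\<pi> (nodes F)))))"
proof -
  have "(1::nat) \<le> 3" "(1::nat) \<le> 2"
    by simp_all
  then obtain T S where "constantly_bounded T" "linearly_bounded S"
    and sim: "simulates R (bounded_degree_rep 3 2) T S"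
    using univ unfolding strongly_universal_def by blast
  then obtain t a b where le: "\<And>n. T n \<le> t" "\<And>n. S n \<le> a * n + b"
    unfolding constantly_bounded_def linearly_bounded_def is_linear_def by blast
  \<comment> \<open>Chosen to give \<open>nodes F \<le> d * j\<close> for counters with
    \<open>n = 2 * j\<close> digits; the 4 comes from \<open>2 * j + 2 \<le> 4 * j\<close>. Hence
    \<open>c ^ nodes F \<le> 2 ^ j\<close>.\<close>
  define d where "d = 4 * (a + b + 1)"
  define c :: real where "c = root d 2"
  have d: "0 < d"
    by (simp add: d_def)
  then have c: "1 < c" "c ^ d = 2"
    by (simp_all add: c_def)
  have "\<exists>F \<in> \<F>. N \<le> nodes F \<and>
      (\<exists>x \<in> configs F. c ^ nodes F \<le> real (period F x)) \<and>
      (\<exists>x \<in> configs F. c ^ nodes F \<le> real (transient F x)) \<and>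
      c ^ nodes F \<le> real (card (periodic_orbits F t))" for N
  proof -
    \<comment> \<open>Only \<open>2 ^ j\<close> out of \<open>2 ^ (2 * j)\<close> is claimed: the
      other half of the exponent pays for the division by \<open>T\<close>, which is below
      \<open>2 ^ j\<close> because \<open>j\<close> exceeds \<open>t\<close>.\<close>
    define j where "j = N + t + 1"
    define n where "n = 2 * j"
    have "counter n \<in> Range (bounded_degree_rep 3 2)"
      unfolding Range_bounded_degree_rep by (rule counter_bounded_degree)
    from simulates_orbit_embedding[OF std sim this automata_network_counter]
    obtain F \<phi> where F: "F \<in> \<F>" "orbit_embedding (counter n) F \<phi> (T (n + 2))"
      "nodes F = S (n + 2)" "n + 2 \<le> nodes F"
      by auto
    have n: "0 < n"
      by (simp add: n_def j_def)
    note big = orbit_embedding_counter[OF F(2) n le(1)]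
    have "nodes F \<le> a * (n + 2) + b"
      unfolding F(3) by (rule le(2))
    also have "\<dots> \<le> (a + b + 1) * (n + 2)"
      by (simp add: algebra_simps)
    also have "\<dots> \<le> (a + b + 1) * (4 * j)"
      by (intro mult_le_mono2) (simp add: n_def j_def)
    also have "\<dots> = d * j"
      by (simp add: d_def algebra_simps)
    finally have "c ^ nodes F \<le> c ^ (d * j)"
      using c(1) by (intro power_increasing) auto
    also have "\<dots> = real (2 ^ j)"
      by (simp add: power_mult c(2))
    finally have pow: "c ^ nodes F \<le> real (2 ^ j)" .
    have "(2::nat) ^ j \<le> 2 ^ n"
      by (intro power_increasing) (simp_all add: n_def)
    then have pow_n: "c ^ nodes F \<le> real y" if "2 ^ n \<le> y" for y
      using pow that by (meson le_trans of_nat_le_iff order_trans)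
    have "T (n + 2) \<le> 2 ^ j"
      using le(1)[of "n + 2"] less_exp[of j] by (simp add: j_def)
    then have "2 ^ (n + 2) \<le> card (periodic_orbits F t) * 2 ^ j"
      using big(3) by (meson le_trans mult_le_mono2)
    moreover have "(2::nat) ^ j * 2 ^ j \<le> 2 ^ (n + 2)"
      unfolding power_add[symmetric] by (intro power_increasing) (simp_all add: n_def)
    ultimately have "2 ^ j * 2 ^ j \<le> card (periodic_orbits F t) * 2 ^ j"
      by (rule order_trans[rotated])
    then have "2 ^ j \<le> card (periodic_orbits F t)"
      by simp
    then have "c ^ nodes F \<le> real (card (periodic_orbits F t))"
      using pow by (meson of_nat_le_iff order_trans)
    moreover have "N \<le> nodes F"
      using F(4) by (simp add: n_def j_def)
    ultimately show ?thesis
      using F(1) big(1,2) pow_n by blast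
  qed
  moreover have "is_linear (\<lambda>_. t)"
    unfolding is_linear_def by (intro exI[of _ 0] exI[of _ t]) simp
  ultimately show ?thesis
    using c(1) by (intro exI[of _ c] conjI exI[of _ "\<lambda>_. t"]) blast+
qed

theorem mainTheorem10:
  fixes m :: "nat \<Rightarrow> nat \<Rightarrow> bool list"
    and \<F> :: "network set"
    and R :: representation
  assumes "symbol_coding m"
    and "standard_representation m \<F> R"
  shows "(universal m R \<longrightarrow>
           (\<forall>\<rho>. is_polynomial \<rho> \<longrightarrow>
              (\<exists>\<delta>. is_polynomial \<delta> \<and>
                 (\<forall>H. succinct m \<rho> H \<longrightarrow> (\<exists>F \<in> \<F>. embeds_with_distortion \<delta> H F)))) \<and>
           (\<exists>\<pi>. is_polynomial \<pi> \<and>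
              (\<forall>P. is_polynomial P \<longrightarrow>
                 (\<forall>N. \<exists>F \<in> \<F>. N \<le> nodes F \<and>
                    (\<exists>x \<in> configs F. P (nodes F) < period F x) \<and>
                    (\<exists>x \<in> configs F. P (nodes F) < transient F x) \<and>
                    P (nodes F) < card (periodic_orbits F (\<pi> (nodes F))))))) \<and>
         (strongly_universal R \<longrightarrow>
           (\<forall>q\<ge>1. \<forall>\<Delta>\<ge>1. \<exists>\<delta>. is_linear \<delta> \<and>
              (\<forall>H \<in> bounded_degree q \<Delta>. \<exists>F \<in> \<F>. embeds_with_distortion \<delta> H F)) \<and>
           (\<exists>c > (1::real). \<exists>\<pi>. is_linear \<pi> \<and>
              (\<forall>N. \<exists>F \<in> \<F>. N \<le> nodes F \<and>
                 (\<exists>x \<in> configs F. c ^ nodes F \<le> real (period F x)) \<and>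
                 (\<exists>x \<in> configs F. c ^ nodes F \<le> real (transient F x)) \<and>
                 c ^ nodes F \<le> real (card (periodic_orbits F (\<pi> (nodes F)))))))"
  using universal_embeds_succinct[OF assms] universal_rich_dynamics[OF assms]
    strongly_universal_embeds_bounded_degree[OF assms(2)]
    strongly_universal_rich_dynamics[OF assms(2)]
  by blast

end
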